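(* Let $S$ be a numerical semigroup with multiplicity $m$, $E$ an ideal of $S$ with $0\notin E$, $b\in S$ an odd integer, $k$ a field, and let $D=k[\![S\Join^b E]\!]$ with maximal ideal $\mathfrak n$. The associated graded ring $\operatorname{gr}_{\mathfrak n}(D)$ is Cohen-Macaulay if and only if $a_i(S)=b_i(S)$ and $a_i(E)=b_i(E)$ for all $i=0,\dots,m-1$.
   Context: A numerical semigroup is a submonoid $S$ of $(\mathbb N,+)$ with $\mathbb N\setminus S$ finite; its multiplicity $m$ is its smallest nonzero element; $k[\![S]\!]=k[\![t^s\mid s\in S]\!]\subseteq k[\![t]\!]$. An ideal of $S$ is a non-empty set $E\subseteq S$ with $E+S\subseteq E$. For an odd $b\in S$, the numerical duplication is the numerical semigroup $S\Join^b E=\{2s\mid s\in S\}\cup\{2e+b\mid e\in E\}$. $\operatorname{gr}_{\mathfrak n}(D)=\bigoplus_{i\ge0}\mathfrak n^i/\mathfrak n^{i+1}$. Let $M=S\setminus\{0\}$, $lM=M+\dots+M$ ($l$ summands), $0M=S$. For sets of integers, $X-Y=\{z\in\mathbb Z\mid z+Y\subseteq X\}$. The blowup of $S$ is the numerical semigroup $S'=\bigcup_l(lM-lM)$. Let $\omega_i$ (resp. $\omega_i'$) be the smallest element of $S$ (resp. $S'$) congruent to $i$ modulo $m$. The integer $a_i(S)$ is defined by $\omega_i'+m\,a_i(S)=\omega_i$, and $b_i(S)=\max\{l\mid\omega_i\in lM\}$. $\operatorname{ord}_E(e)=\max\{l+1\mid e\in lM+E\}$ for $e\in E$. Let $\alpha_i$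 be the smallest element of $E$ congruent to $i$ modulo $m$. Let $E'=\bigcup_{l\ge1}\big((E+(l-1)M)-lM\big)$ and let $\alpha_i'$ be the smallest element of $E'$ congruent to $i$ modulo $m$. Then $a_i(E)$ is the unique integer with $\alpha_i'+m\,a_i(E)=\alpha_i$, and $b_i(E)=\operatorname{ord}_E(\alpha_i)$. *)

theory Defs
  imports
    "HOL-Algebra.Ring_Divisibility"
    "HOL-Algebra.Ideal_Product"
    "HOL-Computational_Algebra.Formal_Power_Series"
    "HOL-Library.Extended_Nat"
    "HOL-Library.Set_Algebras"
    "HOL-Number_Theory.Cong"
begin

section \<open>Numerical semigroups and numerical duplication\<close>

definition numerical_semigroup :: "nat set \<Rightarrow> bool" where
  "numerical_semigroup S \<longleftrightarrow>
     0 \<in> S \<and> (\<forall>x\<in>S. \<forall>y\<in>S. x + y \<in> S) \<and> finite (- S)"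

definition sg_multiplicity :: "nat set \<Rightarrow> nat" where
  "sg_multiplicity S = (LEAST n. n \<in> S \<and> n \<noteq> 0)"

text \<open>Sums of sets, here and below, are elementwise sums (\<^theory>\<open>HOL-Library.Set_Algebras\<close>).\<close>

definition semigroup_ideal :: "nat set \<Rightarrow> nat set \<Rightarrow> bool" where
  "semigroup_ideal S E \<longleftrightarrow> E \<noteq> {} \<and> E \<subseteq> S \<and> E + S \<subseteq> E"

definition duplication :: "nat set \<Rightarrow> nat \<Rightarrow> nat set \<Rightarrow> nat set" where
  "duplication S b E = {2 * s | s. s \<in> S} \<union> {2 * e + b | e. e \<in> E}"

text \<open>The set \<open>lM\<close> with \<open>M = S - {0}\<close>; note the convention \<open>0M = S\<close>.\<close>

definition mult_M :: "nat set \<Rightarrow> nat \<Rightarrow> nat set" where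
  "mult_M S l = (if l = 0 then S else \<Sum>j<l. S - {0})"

text \<open>The difference \<open>X - Y\<close> is formed in the integers, so it may contain negative numbers.\<close>

definition set_colon :: "nat set \<Rightarrow> nat set \<Rightarrow> int set" where
  "set_colon X Y = {z. \<forall>y\<in>Y. z + int y \<in> int ` X}"

definition blowup :: "nat set \<Rightarrow> int set" where
  "blowup S = (\<Union>l. set_colon (mult_M S l) (mult_M S l))"

definition ideal_blowup :: "nat set \<Rightarrow> nat set \<Rightarrow> int set" where
  "ideal_blowup S E = (\<Union>l\<in>{1..}. set_colon (E + mult_M S (l - 1)) (mult_M S l))"

definition least_cong :: "nat \<Rightarrow> int set \<Rightarrow> nat \<Rightarrow> int" where
  "least_cong m X i = (LEAST z. z \<in> X \<and> [z = int i] (mod int m))"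

definition a_sg :: "nat set \<Rightarrow> nat \<Rightarrow> int" where
  "a_sg S i = (let m = sg_multiplicity S in
     THE a. least_cong m (blowup S) i + int m * a = least_cong m (int ` S) i)"

definition b_sg :: "nat set \<Rightarrow> nat \<Rightarrow> nat" where
  "b_sg S i = Max {l. least_cong (sg_multiplicity S) (int ` S) i \<in> int ` mult_M S l}"

definition ord_ideal :: "nat set \<Rightarrow> nat set \<Rightarrow> nat \<Rightarrow> nat" where
  "ord_ideal S E e = Max {l + 1 | l. e \<in> mult_M S l + E}"

definition a_ideal :: "nat set \<Rightarrow> nat set \<Rightarrow> nat \<Rightarrow> int" where
  "a_ideal S E i = (let m = sg_multiplicity S in
     THE a. least_cong m (ideal_blowup S E) i + int m * a = least_cong m (int ` E) i)"

definition b_ideal :: "nat set \<Rightarrow> nat set \<Rightarrow> nat \<Rightarrow> nat" where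
  "b_ideal S E i = ord_ideal S E (nat (least_cong (sg_multiplicity S) (int ` E) i))"


section \<open>Semigroup rings\<close>

definition semigroup_ring :: "nat set \<Rightarrow> 'k::field fps ring" where
  "semigroup_ring T =
     \<lparr>carrier = {f. \<forall>n. fps_nth f n \<noteq> 0 \<longrightarrow> n \<in> T},
      mult = (*), one = 1, zero = 0, add = (+)\<rparr>"


section \<open>The associated graded ring of an ideal\<close>

abbreviation ideal_pow :: "('a, 'c) ring_scheme \<Rightarrow> 'a set \<Rightarrow> nat \<Rightarrow> 'a set" where
  "ideal_pow R I i \<equiv> I [^]\<^bsub>ideals_set R\<^esub> i"

text \<open>The piece \<open>I\<^sup>i / I\<^sup>i\<^sup>+\<^sup>1\<close>, as an additive subgroup of the quotient ring \<open>R / I\<^sup>i\<^sup>+\<^sup>1\<close>.\<close>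

definition graded_piece :: "('a, 'c) ring_scheme \<Rightarrow> 'a set \<Rightarrow> nat \<Rightarrow> 'a set set" where
  "graded_piece R I i = (\<lambda>a. ideal_pow R I (Suc i) +>\<^bsub>R\<^esub> a) ` ideal_pow R I i"

text \<open>
  Elements of the direct sum are finitely supported families of cosets. The product of homogeneous
  elements \<open>x + I\<^sup>i\<^sup>+\<^sup>1\<close> and \<open>y + I\<^sup>j\<^sup>+\<^sup>1\<close> of degrees \<open>i\<close> and \<open>j\<close> is \<open>x y + I\<^sup>i\<^sup>+\<^sup>j\<^sup>+\<^sup>1\<close>; it is written with
  \<^const>\<open>rcoset_mult\<close>, which applies to cosets of different ideals.
\<close>

definition assoc_graded :: "('a, 'c) ring_scheme \<Rightarrow> 'a set \<Rightarrow> (nat \<Rightarrow> 'a set) ring" where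
  "assoc_graded R I =
    (let Q = (\<lambda>i. R Quot (ideal_pow R I (Suc i))) in
     \<lparr>carrier = {x. (\<forall>i. x i \<in> graded_piece R I i) \<and> finite {i. x i \<noteq> \<zero>\<^bsub>Q i\<^esub>}},
      mult = (\<lambda>x y d. \<Oplus>\<^bsub>Q d\<^esub> i\<in>{..d}. ([mod (ideal_pow R I (Suc d)):] (x i) \<Otimes>\<^bsub>R\<^esub> (y (d - i)))),
      one = (\<lambda>i. if i = 0 then \<one>\<^bsub>Q i\<^esub> else \<zero>\<^bsub>Q i\<^esub>),
      zero = (\<lambda>i. \<zero>\<^bsub>Q i\<^esub>),
      add = (\<lambda>x y i. x i \<oplus>\<^bsub>Q i\<^esub> y i)\<rparr>)"


section \<open>Cohen-Macaulay rings\<close>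

text \<open>
  The definition is the one in Eisenbud, Commutative Algebra with a View Toward Algebraic Geometry,
  Section 18.2: a Noetherian ring is Cohen-Macaulay if \<open>depth P = codim P\<close> for every maximal
  ideal \<open>P\<close>, where \<open>depth P\<close> is the length of a longest regular sequence in \<open>P\<close>, and \<open>codim P\<close> is
  the height of \<open>P\<close>. The condition on \<open>r\<close> below says that the class of \<open>xs ! i\<close> is a nonzerodivisor
  modulo the ideal generated by its predecessors.
\<close>

definition regular_sequence :: "('a, 'c) ring_scheme \<Rightarrow> 'a list \<Rightarrow> bool" where
  "regular_sequence R xs \<longleftrightarrow>
     set xs \<subseteq> carrier R \<and> Idl\<^bsub>R\<^esub> (set xs) \<noteq> carrier R \<and>
     (\<forall>i<length xs. \<forall>r\<in>carrier R.
        r \<otimes>\<^bsub>R\<^esub> (xs ! i) \<in> Idl\<^bsub>R\<^esub> (set (take i xs)) \<longrightarrow> r \<in> Idl\<^bsub>R\<^esub> (set (take i xs)))"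

definition ideal_depth :: "('a, 'c) ring_scheme \<Rightarrow> 'a set \<Rightarrow> enat" where
  "ideal_depth R I = Sup {enat (length xs) | xs. regular_sequence R xs \<and> set xs \<subseteq> I}"

definition prime_height :: "('a, 'c) ring_scheme \<Rightarrow> 'a set \<Rightarrow> enat" where
  "prime_height R P = Sup {enat n | n. \<exists>p :: nat \<Rightarrow> 'a set.
     (\<forall>i\<le>n. primeideal (p i) R) \<and> (\<forall>i<n. p i \<subset> p (Suc i)) \<and> p n = P}"

definition cohen_macaulay :: "('a, 'c) ring_scheme \<Rightarrow> bool" where
  "cohen_macaulay R \<longleftrightarrow>
     cring R \<and> noetherian_ring R \<and> (\<forall>P. maximalideal P R \<longrightarrow> ideal_depth R P = prime_height R P)"

end

theory Submission
  imports Defs "HOL-Computational_Algebra.Polynomial"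
begin

text \<open>
  Let \<open>T\<close> be the duplication and \<open>ord\<close> the order in \<open>T\<close>. Since \<open>\<nn>\<^sup>i\<close> consists of the series supported
  in orders at least \<open>i\<close>, the associated graded ring has the monomials \<open>t\<^sup>s\<close>, \<open>s \<in> T\<close>, as a basis, and
  \<open>t\<^sup>s t\<^sup>u\<close> is \<open>t\<^sup>s\<^sup>+\<^sup>u\<close> or \<open>0\<close> according to whether \<open>ord (s + u) = ord s + ord u\<close>. Let \<open>\<mu>\<close> be the multiplicity of \<open>T\<close>
  and \<open>x = t\<^sup>\<mu>\<close>. The defect \<open>s - \<mu> ord s\<close> is additive on nonzero products and bounded on \<open>T\<close>, so the graded ring
  is \<open>k[x]\<close> plus a nilpotent ideal. Hence every maximal ideal has height \<open>1\<close>, and the ring is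
  Cohen-Macaulay exactly when \<open>x\<close> is a nonzerodivisor, that is, when \<open>ord (s + \<mu>) = ord s + 1\<close> on \<open>T\<close>.

  Two odd elements \<open>2 e\<^sub>1 + b\<close>, \<open>2 e\<^sub>2 + b\<close> of \<open>T\<close> add up to two even ones, \<open>2 e\<^sub>1\<close> and \<open>2 (e\<^sub>2 + b)\<close>. Therefore
  the order of \<open>2 s\<close> is that of \<open>s\<close> in \<open>S\<close>, and the order of \<open>2 e + b\<close> is that of \<open>e\<close> in \<open>E\<close>. Finally \<open>z\<close> lies
  in the blowup of \<open>S\<close> iff \<open>z + l m \<in> l M\<close> for some \<open>l\<close>, and similarly for \<open>E\<close>; this turns
  the equalities \<open>a\<^sub>i = b\<^sub>i\<close> into the statement that adding \<open>m\<close> raises the order by exactly one.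
\<close>

section \<open>Orders in numerical semigroups\<close>

text \<open>Meaningful only for \<open>s\<close> in \<open>S\<close>: elsewhere the set is empty and
  \<open>Max\<close> has no specified value.\<close>

definition sg_ord :: "nat set \<Rightarrow> nat \<Rightarrow> nat" where
  "sg_ord S s = Max {l. s \<in> mult_M S l}"

lemma mult_M_0 [simp]: "mult_M S 0 = S"
  by (simp add: mult_M_def)

locale numerical_sg =
  fixes S :: "nat set"
  assumes ns: "numerical_semigroup S"
begin

abbreviation m :: nat where "m \<equiv> sg_multiplicity S"

lemma zero_in: "0 \<in> S"
  and add_in: "x \<in> S \<Longrightarrow> y \<in> S \<Longrightarrow> x + y \<in> S"
  and finite_compl: "finite (- S)"
  using ns by (auto simp: numerical_semigroup_def)

lemma ex_conductor: obtains c where "\<And>n. n \<ge> c \<Longrightarrow> n \<in> S"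
proof -
  obtain c where "\<forall>n\<in>-S. n < c"
    using finite_nat_set_iff_bounded finite_compl by blast
  then have "n \<in> S" if "n \<ge> c" for n
    using that by (metis Compl_iff not_less)
  then show thesis by (rule that)
qed

lemma m_in: "m \<in> S" and m_pos: "m > 0"
proof -
  obtain c where c: "\<And>n. n \<ge> c \<Longrightarrow> n \<in> S" using ex_conductor by blast
  have "Suc c \<in> S \<and> Suc c \<noteq> 0" using c by simp
  then have "m \<in> S \<and> m \<noteq> 0" unfolding sg_multiplicity_def by (rule LeastI)
  then show "m \<in> S" "m > 0" by auto
qed

lemma m_le: "s \<in> S \<Longrightarrow> s \<noteq> 0 \<Longrightarrow> m \<le> s"
  unfolding sg_multiplicity_def by (rule Least_le) simp

lemma add_mult_m_in: "s \<in> S \<Longrightarrow> s + k * m \<in> S"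
  by (induction k) (auto simp: algebra_simps dest: add_in[OF m_in])

text \<open>Since \<open>M + S = M\<close>, the convention \<open>0M = S\<close> lets one recursion
  cover \<open>l = 0\<close> as well; later inductions peel off one nonzero summand with it.\<close>

lemma mult_M_Suc: "x \<in> mult_M S (Suc l) \<longleftrightarrow> (\<exists>a\<in>S - {0}. \<exists>y\<in>mult_M S l. x = a + y)"
proof (cases l)
  case 0
  show ?thesis
  proof
    assume "x \<in> mult_M S (Suc l)"
    then have "x \<in> S - {0}" "x = x + 0" using 0 by (auto simp: mult_M_def)
    then show "\<exists>a\<in>S - {0}. \<exists>y\<in>mult_M S l. x = a + y" using 0 zero_in by fastforce
  next
    assume "\<exists>a\<in>S - {0}. \<exists>y\<in>mult_M S l. x = a + y"
    then show "x \<in> mult_M S (Suc l)" using 0 add_in by (auto simp: mult_M_def)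
  qed
next
  case (Suc k)
  have "mult_M S (Suc l) = (S - {0}) + mult_M S l"
    using Suc by (simp add: mult_M_def add.commute)
  then show ?thesis by (simp add: set_plus_def)
qed

lemma mult_M_antimono_Suc: "mult_M S (Suc l) \<subseteq> mult_M S l"
proof (induction l)
  case 0
  show ?case
  proof
    fix x assume "x \<in> mult_M S (Suc 0)"
    then obtain a y where "a \<in> S" "y \<in> S" "x = a + y" by (auto simp: mult_M_Suc)
    then show "x \<in> mult_M S 0" using add_in by simp
  qed
next
  case (Suc l)
  show ?case
  proof
    fix x assume "x \<in> mult_M S (Suc (Suc l))"
    then obtain a y where "a \<in> S - {0}" "y \<in> mult_M S l" "x = a + y"
      using Suc mult_M_Suc[of x "Suc l"] by blast
    then show "x \<in> mult_M S (Suc l)" using mult_M_Suc by blast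
  qed
qed

lemma mult_M_antimono: "l \<le> l' \<Longrightarrow> mult_M S l' \<subseteq> mult_M S l"
  using lift_Suc_antimono_le[of "mult_M S" l l'] mult_M_antimono_Suc by blast

lemma mult_M_subset: "mult_M S l \<subseteq> S"
  using mult_M_antimono[of 0 l] by simp

lemma mult_M_ge: "x \<in> mult_M S l \<Longrightarrow> l * m \<le> x"
proof (induction l arbitrary: x)
  case (Suc l)
  then obtain a y where "a \<in> S" "a \<noteq> 0" "y \<in> mult_M S l" "x = a + y"
    by (auto simp: mult_M_Suc)
  then show ?case using Suc.IH[of y] m_le[of a] by simp
qed simp

lemma mult_M_add: "x \<in> mult_M S l \<Longrightarrow> y \<in> mult_M S l' \<Longrightarrow> x + y \<in> mult_M S (l + l')"
proof (induction l arbitrary: x)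
  case 0
  show ?case
  proof (cases "l' = 0 \<or> x = 0")
    case True
    then show ?thesis using 0 add_in by auto
  next
    case False
    \<comment> \<open>A nonzero \<open>x\<close> even raises the level of \<open>y\<close>, which is
      more than the claim asks for.\<close>
    then have "x + y \<in> mult_M S (Suc l')" using 0 by (auto simp: mult_M_Suc)
    then show ?thesis using mult_M_antimono_Suc[of l'] by auto
  qed
next
  case (Suc l)
  then obtain a z where "a \<in> S - {0}" "z \<in> mult_M S l" "x = a + z"
    using mult_M_Suc by blast
  moreover from this have "z + y \<in> mult_M S (l + l')" using Suc by blast
  ultimately show ?case
    by (metis add_Suc mult_M_Suc add.assoc)
qed

lemma mult_m_in_mult_M: "l * m \<in> mult_M S l"
proof (induction l)
  case (Suc l)
  then show ?case using m_in m_pos by (auto simp: mult_M_Suc)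
qed (simp add: zero_in)

lemma one_le_mult_M: "s \<in> S \<Longrightarrow> s \<noteq> 0 \<Longrightarrow> s \<in> mult_M S 1"
  using mult_M_Suc[of s 0] zero_in by force

text \<open>The sets \<open>lM\<close> decrease with \<open>l\<close>, and elements of
  \<open>lM\<close> are at least \<open>l * m\<close>, so the admissible \<open>l\<close> form a
  finite initial segment.\<close>

lemma mem_mult_M_iff:
  assumes "s \<in> S"
  shows "s \<in> mult_M S l \<longleftrightarrow> l \<le> sg_ord S s"
proof -
  let ?A = "{l. s \<in> mult_M S l}"
  have fin: "finite ?A"
  proof (rule finite_subset[of _ "{..s}"])
    have "l \<le> s" if "s \<in> mult_M S l" for l
      using mult_M_ge[OF that] m_pos by (metis One_nat_def Suc_leI le_trans mult.right_neutral mult_le_mono2)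
    then show "?A \<subseteq> {..s}" by blast
  qed simp
  have ne: "0 \<in> ?A" using assms by simp
  have "Max ?A \<in> ?A" using Max_in[OF fin] ne by blast
  then show ?thesis
    using Max_ge[OF fin, of l] mult_M_antimono[of l "Max ?A"]
    by (auto simp: sg_ord_def)
qed

lemma sg_ord_eqI: "s \<in> S \<Longrightarrow> (\<And>l. s \<in> mult_M S l \<longleftrightarrow> l \<le> n) \<Longrightarrow> sg_ord S s = n"
  using mem_mult_M_iff[of s "sg_ord S s"] mem_mult_M_iff[of s n] by (simp add: order_antisym)

lemma sg_ord_add: "s \<in> S \<Longrightarrow> u \<in> S \<Longrightarrow> sg_ord S s + sg_ord S u \<le> sg_ord S (s + u)"
  using mem_mult_M_iff[of s "sg_ord S s"] mem_mult_M_iff[of u "sg_ord S u"]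
    mem_mult_M_iff[OF add_in[of s u], of "sg_ord S s + sg_ord S u"] 
    mult_M_add[of s "sg_ord S s" u "sg_ord S u"] by simp

lemma sg_ord_ge: "s \<in> S \<Longrightarrow> sg_ord S s * m \<le> s"
  using mult_M_ge mem_mult_M_iff by blast

text \<open>Multiples of \<open>m\<close> attain the bound
  \<open>sg_ord S s * m \<le> s\<close>.\<close>

lemma sg_ord_mult_m: "sg_ord S (k * m) = k"
proof (rule sg_ord_eqI)
  show "k * m \<in> S" using add_mult_m_in[OF zero_in, of k] by simp
  fix l
  show "k * m \<in> mult_M S l \<longleftrightarrow> l \<le> k"
    using mult_M_ge[of "k * m" l] m_pos mult_M_antimono[of l k] mult_m_in_mult_M[of k] by auto
qed

lemma sg_ord_0 [simp]: "sg_ord S 0 = 0"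
  using sg_ord_mult_m[of 0] by simp

end

section \<open>Least elements of residue classes, and a criterion for filtrations\<close>

lemma least_cong_props:
  fixes X :: "int set"
  assumes "\<And>x. x \<in> X \<Longrightarrow> c \<le> x" "\<exists>x\<in>X. [x = int i] (mod int m)"
  shows "least_cong m X i \<in> X" "[least_cong m X i = int i] (mod int m)"
    "\<And>x. x \<in> X \<Longrightarrow> [x = int i] (mod int m) \<Longrightarrow> least_cong m X i \<le> x"
proof -
  let ?P = "\<lambda>z. z \<in> X \<and> [z = int i] (mod int m)"
  \<comment> \<open>\<open>LEAST\<close> on the integers needs a witness; counting upwards from the
    lower bound \<open>c\<close> turns the search into one over the natural numbers.\<close>
  define n where "n = (LEAST k. ?P (c + int k))"
  have ex: "\<exists>k. ?P (c + int k)"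
  proof -
    obtain x where x: "x \<in> X" "[x = int i] (mod int m)" using assms(2) by blast
    then have "x = c + int (nat (x - c))" using assms(1) by simp
    then show ?thesis using x by metis
  qed
  then have P: "?P (c + int n)" unfolding n_def by (rule LeastI_ex)
  have le: "c + int n \<le> z" if "?P z" for z
  proof -
    define k where "k = nat (z - c)"
    have "z = c + int k" using assms(1)[of z] that by (simp add: k_def)
    moreover from this that have "n \<le> k"
      unfolding n_def using Least_le[of "\<lambda>k. ?P (c + int k)" k] by auto
    ultimately show ?thesis by simp
  qed
  have eq: "least_cong m X i = c + int n"
    unfolding least_cong_def by (rule Least_equality) (use P le in auto)
  show "least_cong m X i \<in> X" "[least_cong m X i = int i] (mod int m)" using P eq by auto
  show "\<And>x. x \<in> X \<Longrightarrow> [x = int i] (mod int m) \<Longrightarrow> least_cong m X i \<le> x" using le eq by auto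
qed

text \<open>
  Both halves of the criterion are instances of one statement about a filtration \<open>F\<close> of a set
  \<open>X = F 0\<close>: for \<open>F l = l M\<close> it concerns \<open>S\<close>, for \<open>F l = E + (l - 1) M\<close> it concerns \<open>E\<close>.
\<close>

lemma filtration_criterion:
  fixes F :: "nat \<Rightarrow> nat set" and m :: nat
  defines "B \<equiv> {z. \<exists>l. z + int (l * m) \<in> int ` F l}"
  assumes m: "m > 0"
    and Suc: "\<And>l x. x \<in> F l \<Longrightarrow> x + m \<in> F (Suc l)"
    and anti: "\<And>l. F (Suc l) \<subseteq> F l"
    and ge: "\<And>l x. x \<in> F l \<Longrightarrow> l * m \<le> x + c"
    and cofin: "finite (- F 0)"
    and w: "\<And>i. w i = least_cong m (int ` F 0) i"
    and ord: "\<And>l i. int l \<le> b i \<longleftrightarrow> w i \<in> int ` F l"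
  shows "(\<forall>i<m. (THE a. least_cong m B i + int m * a = w i) = b i)
    \<longleftrightarrow> (\<forall>l. \<forall>x\<in>F 0. x + m \<in> F (Suc l) \<longrightarrow> x \<in> F l)"
proof -
  have F_anti: "F l' \<subseteq> F l" if "l \<le> l'" for l l'
    using lift_Suc_antimono_le[of F l l'] anti that by blast
  have F_add: "x + k * m \<in> F (l + k)" if "x \<in> F l" for x l k
    using that by (induction k) (auto simp: algebra_simps dest: Suc)
  have X_add: "x + k * m \<in> F 0" if "x \<in> F 0" for x k
    using F_add[OF that, of k] F_anti[of 0 k] by auto
  have ex: "\<exists>x\<in>F 0. [int x = int i] (mod int m)" for i
  proof -
    obtain c where c: "\<forall>n\<in>-F 0. n < c"
      using finite_nat_set_iff_bounded cofin by blast
    have "i + m * c \<ge> c" using m by (simp add: trans_le_add2)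
    then have "i + m * c \<in> F 0" using c by (metis Compl_iff not_less)
    moreover have "[int (i + m * c) = int i] (mod int m)" by (simp add: cong_def)
    ultimately show ?thesis by blast
  qed
  have w_in: "w i \<in> int ` F 0" and w_cong: "[w i = int i] (mod int m)"
    and w_le: "x \<in> F 0 \<Longrightarrow> [int x = int i] (mod int m) \<Longrightarrow> w i \<le> int x" for i x
  proof -
    have 1: "0 \<le> x" if "x \<in> int ` F 0" for x using that by auto
    have 2: "\<exists>x\<in>int ` F 0. [x = int i] (mod int m)" for i using ex[of i] by blast
    note P = least_cong_props[OF 1 2, folded w]
    show "w i \<in> int ` F 0" "[w i = int i] (mod int m)" using P by auto
    show "x \<in> F 0 \<Longrightarrow> [int x = int i] (mod int m) \<Longrightarrow> w i \<le> int x" using P by blast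
  qed
  have X_form: "\<exists>j. int x = w i + int (j * m)" if "x \<in> F 0" "[int x = int i] (mod int m)" for x i
  proof -
    have "[int x = w i] (mod int m)" using that w_cong cong_trans cong_sym by blast
    then obtain k where k: "int x = w i + int m * k"
      by (metis cong_iff_lin cong_sym mult.commute)
    with w_le[OF that] m have "k \<ge> 0" by (auto simp: zero_le_mult_iff)
    with k show ?thesis by (intro exI[of _ "nat k"]) simp
  qed
  have B_ge: "- int c \<le> z" if "z \<in> B" for z
    using that ge unfolding B_def by (force simp flip: of_nat_mult of_nat_add)
  have X_B: "int ` F 0 \<subseteq> B"
    unfolding B_def by (auto intro!: exI[of _ 0])
  have exB: "\<exists>x\<in>B. [x = int i] (mod int m)" for i
    using ex[of i] X_B by blast
  define v where "v i = least_cong m B i" for i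
  have v_in: "v i \<in> B" and v_cong: "[v i = int i] (mod int m)"
    and v_le: "z \<in> B \<Longrightarrow> [z = int i] (mod int m) \<Longrightarrow> v i \<le> z" for i z
    unfolding v_def using least_cong_props[of B "- int c" i m, OF B_ge exB] by auto
  \<comment> \<open>\<open>v i\<close> and \<open>w i\<close> lie in the same class and
    \<open>m > 0\<close>, so the equation has exactly one solution and \<open>THE\<close> selects
    it.\<close>
  have the_iff: "(THE a. v i + int m * a = w i) = b i \<longleftrightarrow> v i + int m * b i = w i" for i
  proof -
    have "[v i = w i] (mod int m)" using v_cong w_cong cong_trans cong_sym by blast
    then obtain k where k: "w i = v i + int m * k"
      by (metis cong_iff_lin mult.commute)
    then have "(THE a. v i + int m * a = w i) = k"
      using m by (intro the_equality) auto
    then show ?thesis using k m by auto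
  qed
  have b_ge: "b i \<ge> 0" and w_b: "w i \<in> int ` F (nat (b i))" for i
  proof -
    show "b i \<ge> 0" using ord[of 0 i] w_in by simp
    then show "w i \<in> int ` F (nat (b i))" using ord[of "nat (b i)" i] by simp
  qed
  have "(\<forall>i<m. v i + int m * b i = w i) \<longleftrightarrow> (\<forall>l. \<forall>x\<in>F 0. x + m \<in> F (Suc l) \<longrightarrow> x \<in> F l)"
    (is "?L \<longleftrightarrow> ?R")
  proof
    assume L: ?L
    show ?R
    proof (intro allI ballI impI)
      fix l x assume x: "x \<in> F 0" "x + m \<in> F (Suc l)"
      define i where "i = x mod m"
      have i: "i < m" "[int x = int i] (mod int m)"
        using m by (auto simp: i_def cong_def zmod_int)
      obtain j where j: "int x = w i + int (j * m)" using X_form[OF x(1) i(2)] by blast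
      \<comment> \<open>Adding \<open>(l + 1) m\<close> to \<open>x - l m\<close> gives
        \<open>x + m\<close> in \<open>F (Suc l)\<close>. Hence \<open>v i = w i - m b i\<close> is
        at most \<open>x - l m\<close>, which bounds \<open>l\<close> by
        \<open>b i + j\<close>.\<close>
      have "int x - int (l * m) \<in> B"
        unfolding B_def using x(2) by (auto intro!: exI[of _ "Suc l"] image_eqI[of _ _ "x + m"] simp: algebra_simps)
      moreover have "[int x - int (l * m) = int i] (mod int m)"
        using cong_diff[OF i(2), of "int (l * m)" 0] by (simp add: cong_def)
      ultimately have "v i \<le> int x - int (l * m)" by (rule v_le)
      then have "w i - int m * b i \<le> w i + int (j * m) - int (l * m)"
        using L i(1) j by (smt (verit))
      then have "int m * int l \<le> int m * (int j + b i)" by (simp add: algebra_simps)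
      then have "int l \<le> int j + b i" using m by simp
      then have l: "l \<le> nat (b i) + j" using b_ge[of i] by linarith
      \<comment> \<open>Start from \<open>w i\<close> at level \<open>b i\<close> and add
        \<open>m\<close> exactly \<open>j\<close> times, each time gaining a level.\<close>
      obtain y where y: "y \<in> F (nat (b i))" "w i = int y" using w_b[of i] by blast
      then have "x = y + j * m" using j by (simp flip: of_nat_add of_nat_mult)
      with y F_add F_anti[OF l] show "x \<in> F l" by blast
    qed
  next
    assume R: ?R
    show ?L
    proof (intro allI impI)
      fix i assume "i < m"
      \<comment> \<open>Iterated use of \<open>?R\<close>. The truncated difference covers
        \<open>j > l\<close>, where only membership in \<open>F 0\<close> is claimed.\<close>
      have down: "x \<in> F (l - j)" if "x + j * m \<in> F l" "x \<in> F 0" for x l j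
        using that
      proof (induction j arbitrary: l)
        case (Suc j)
        show ?case
        proof (cases l)
          case 0
          then show ?thesis using Suc by simp
        next
          case (Suc k)
          have "(x + j * m) + m \<in> F (Suc k)" using Suc Suc.prems by (simp add: algebra_simps)
          then have "x + j * m \<in> F k" using R X_add[OF Suc.prems(2)] by blast
          then show ?thesis using Suc.IH[of k] Suc.prems Suc by simp
        qed
      qed simp
      obtain y where y: "y \<in> F (nat (b i))" "w i = int y" using w_b[of i] by blast
      \<comment> \<open>The level \<open>b i\<close> of \<open>w i\<close> itself witnesses
        membership in \<open>B\<close>; this is the upper bound for \<open>v i\<close>.\<close>
      have "w i - int m * b i \<in> B"
        unfolding B_def using w_b[of i] b_ge[of i] by (auto intro!: exI[of _ "nat (b i)"])
      moreover have "[w i - int m * b i = int i] (mod int m)"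
        using w_cong[of i] by (simp add: cong_def mod_diff_eq[symmetric])
      ultimately have "v i \<le> w i - int m * b i" by (rule v_le)
      \<comment> \<open>Conversely, a witness \<open>x = v i + l m\<close> in \<open>F l\<close>
        equals \<open>w i + j m\<close>. Stripping off the \<open>j\<close> copies of
        \<open>m\<close> leaves \<open>w i\<close> in \<open>F (l - j)\<close>, so
        \<open>l - j\<close> is at most \<open>b i\<close>.\<close>
      moreover have "w i - int m * b i \<le> v i"
      proof -
        obtain l x where x: "x \<in> F l" "v i + int (l * m) = int x"
          using v_in[of i] unfolding B_def by blast
        have x0: "x \<in> F 0" using x(1) F_anti[of 0 l] by blast
        have "[int x = int i] (mod int m)"
          using v_cong[of i] unfolding x(2)[symmetric] by (simp add: cong_def)
        then obtain j where j: "int x = w i + int (j * m)" using X_form x0 by blast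
        have "x = y + j * m" using y(2) j by (simp flip: of_nat_add of_nat_mult)
        moreover have "y \<in> F 0" using y(1) F_anti[of 0 "nat (b i)"] by blast
        ultimately have "y \<in> F (l - j)" using x(1) down by blast
        then have "int (l - j) \<le> b i" using ord y(2) by blast
        then have "int l - int j \<le> b i" by linarith
        then have "int m * (int l - int j) \<le> int m * b i" using m by simp
        then show ?thesis using x(2) j by (simp add: algebra_simps)
      qed
      ultimately show "v i + int m * b i = w i" by linarith
    qed
  qed
  then show ?thesis using the_iff unfolding v_def by simp
qed

section \<open>The blowups of a semigroup and of an ideal\<close>

context numerical_sg
begin

text \<open>Adding \<open>m\<close> always raises the order by at least one, so only the upper bound
  is at stake. The right-hand side has the shape of the conclusion of
  \<open>filtration_criterion\<close>.\<close>

lemma sg_ord_add_m_iff: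
  assumes "s \<in> S"
  shows "sg_ord S (s + m) = sg_ord S s + 1 \<longleftrightarrow>
    (\<forall>l. s + m \<in> mult_M S (Suc l) \<longrightarrow> s \<in> mult_M S l)"
proof -
  have 1: "sg_ord S s + 1 \<le> sg_ord S (s + m)"
    using sg_ord_add[OF assms m_in] sg_ord_mult_m[of 1] by simp
  have "(\<forall>l. s + m \<in> mult_M S (Suc l) \<longrightarrow> s \<in> mult_M S l) \<longleftrightarrow>
    (\<forall>l. Suc l \<le> sg_ord S (s + m) \<longrightarrow> l \<le> sg_ord S s)"
    using mem_mult_M_iff[OF assms] mem_mult_M_iff[OF add_in[OF assms m_in]] by simp
  also have "\<dots> \<longleftrightarrow> sg_ord S (s + m) \<le> sg_ord S s + 1"
    by (cases "sg_ord S (s + m)") auto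
  finally show ?thesis using 1 by auto
qed

text \<open>The translates \<open>lM - l m\<close> increase with \<open>l\<close> and start at
  \<open>S\<close>, so their complements in the natural numbers are finite and decreasing. From an
  index with smallest complement on they are constant.\<close>

lemma mult_M_shift_stable:
  obtains R where "R \<ge> 1" "\<And>l z. R \<le> l \<Longrightarrow> z + l * m \<in> mult_M S l \<longleftrightarrow> z + R * m \<in> mult_M S R"
proof -
  define A where "A l = {z. z + l * m \<in> mult_M S l}" for l
  have A_Suc: "A l \<subseteq> A (Suc l)" for l
    unfolding A_def using mult_M_add[OF _ mult_m_in_mult_M[of 1]]
    by (force simp: algebra_simps)
  have A_mono: "A l \<subseteq> A l'" if "l \<le> l'" for l l'
    using lift_Suc_mono_le[of A l l'] A_Suc that by blast
  have fin: "finite (- A l)" for l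
    using finite_subset[OF _ finite_compl] A_mono[of 0 l] unfolding A_def[of 0] by auto
  obtain R where R: "\<And>l. card (- A R) \<le> card (- A l)"
    using ex_has_least_nat[of "\<lambda>_. True" 0 "\<lambda>l. card (- A l)"] by auto
  have eq: "A l = A R" if "R \<le> l" for l
    using card_seteq[OF fin, of "- A l" R] A_mono[OF that] R[of l] by auto
  have "z + l * m \<in> mult_M S l \<longleftrightarrow> z + Suc R * m \<in> mult_M S (Suc R)" if "Suc R \<le> l" for l z
    using eq[of l] eq[of "Suc R"] that unfolding A_def by fastforce
  then show thesis using that[of "Suc R"] by simp
qed

text \<open>One direction evaluates the colon condition at \<open>l m\<close>. For the other, pass
  to the index \<open>l + R\<close>: an element of \<open>(l + R)M\<close> is
  \<open>y' + (l + R) m\<close>, where \<open>y' + R m\<close> lies in \<open>RM\<close> by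
  stability. Then \<open>z + y\<close> is the sum of \<open>z + l m\<close> in \<open>lM\<close> and
  \<open>y' + R m\<close> in \<open>RM\<close>.\<close>

lemma blowup_eq: "blowup S = {z. \<exists>l. z + int (l * m) \<in> int ` mult_M S l}"
proof (intro equalityI subsetI)
  fix z assume "z \<in> blowup S"
  then show "z \<in> {z. \<exists>l. z + int (l * m) \<in> int ` mult_M S l}"
    unfolding blowup_def set_colon_def using mult_m_in_mult_M by blast
next
  fix z assume "z \<in> {z. \<exists>l. z + int (l * m) \<in> int ` mult_M S l}"
  then obtain l x where x: "x \<in> mult_M S l" "z + int (l * m) = int x" by blast
  obtain R where R: "R \<ge> 1" "\<And>l z. R \<le> l \<Longrightarrow> z + l * m \<in> mult_M S l \<longleftrightarrow> z + R * m \<in> mult_M S R"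
    using mult_M_shift_stable by blast
  have "z + int y \<in> int ` mult_M S (l + R)" if y: "y \<in> mult_M S (l + R)" for y
  proof -
    define y' where "y' = y - (l + R) * m"
    have y': "y = y' + (l + R) * m" using mult_M_ge[OF y] by (simp add: y'_def)
    then have "y' + R * m \<in> mult_M S R" using y R(2)[of "l + R"] by simp
    then have "x + (y' + R * m) \<in> mult_M S (l + R)" using x mult_M_add by blast
    moreover have "z + int y = int (x + (y' + R * m))"
      using y' x(2) by (simp add: algebra_simps)
    ultimately show ?thesis by blast
  qed
  then show "z \<in> blowup S" unfolding blowup_def set_colon_def by blast
qed

text \<open>The argument of \<open>blowup_eq\<close> with a summand from \<open>E\<close> carried
  along.\<close>

lemma ideal_blowup_eq:
  "ideal_blowup S E = {z. \<exists>l\<ge>1. z + int (l * m) \<in> int ` (E + mult_M S (l - 1))}"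
proof (intro equalityI subsetI)
  fix z assume "z \<in> ideal_blowup S E"
  then show "z \<in> {z. \<exists>l\<ge>1. z + int (l * m) \<in> int ` (E + mult_M S (l - 1))}"
    unfolding ideal_blowup_def set_colon_def using mult_m_in_mult_M by blast
next
  fix z assume "z \<in> {z. \<exists>l\<ge>1. z + int (l * m) \<in> int ` (E + mult_M S (l - 1))}"
  then obtain l e x where l: "l \<ge> 1" and x: "e \<in> E" "x \<in> mult_M S (l - 1)"
    "z + int (l * m) = int (e + x)" by (auto simp: set_plus_def)
  obtain R where R: "R \<ge> 1" "\<And>l z. R \<le> l \<Longrightarrow> z + l * m \<in> mult_M S l \<longleftrightarrow> z + R * m \<in> mult_M S R"
    using mult_M_shift_stable by blast
  have "z + int y \<in> int ` (E + mult_M S (l + R - 1))" if y: "y \<in> mult_M S (l + R)" for y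
  proof -
    define y' where "y' = y - (l + R) * m"
    have y': "y = y' + (l + R) * m" using mult_M_ge[OF y] by (simp add: y'_def)
    then have "y' + R * m \<in> mult_M S R" using y R(2)[of "l + R"] by simp
    then have "x + (y' + R * m) \<in> mult_M S (l - 1 + R)" using x mult_M_add by blast
    then have "e + (x + (y' + R * m)) \<in> E + mult_M S (l + R - 1)"
      using x(1) l by (auto simp: set_plus_def)
    moreover have "z + int y = int (e + (x + (y' + R * m)))"
      using y' x(3) by (simp add: algebra_simps)
    ultimately show ?thesis by blast
  qed
  then show "z \<in> ideal_blowup S E" unfolding ideal_blowup_def set_colon_def
    using l by (intro UN_I[of "l + R"]) auto
qed

lemma a_eq_b_sg_iff:
  "(\<forall>i<m. a_sg S i = int (b_sg S i)) \<longleftrightarrow> (\<forall>s\<in>S. sg_ord S (s + m) = sg_ord S s + 1)"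
proof -
  define w where "w i = least_cong m (int ` S) i" for i
  have ex: "\<exists>x\<in>int ` S. [x = int i] (mod int m)" for i
  proof -
    obtain c where c: "\<And>n. n \<ge> c \<Longrightarrow> n \<in> S" using ex_conductor by blast
    have "c \<le> i + m * c" using m_pos by (simp add: trans_le_add2)
    then have "int (i + m * c) \<in> int ` S" using c by blast
    moreover have "[int (i + m * c) = int i] (mod int m)" by (simp add: cong_def)
    ultimately show ?thesis by blast
  qed
  have w_in: "w i \<in> int ` S" for i
    unfolding w_def by (rule least_cong_props(1)[of _ 0]) (use ex in auto)
  have b: "b_sg S i = sg_ord S (nat (w i))" for i
    using w_in[of i] by (auto simp: b_sg_def sg_ord_def w_def[symmetric] image_iff)
  have "(\<forall>i<m. a_sg S i = int (b_sg S i)) \<longleftrightarrow>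
      (\<forall>l. \<forall>x\<in>mult_M S 0. x + m \<in> mult_M S (Suc l) \<longrightarrow> x \<in> mult_M S l)"
    unfolding a_sg_def Let_def blowup_eq w_def[symmetric]
  proof (rule filtration_criterion[where c = 0])
    show "x + m \<in> mult_M S (Suc l)" if "x \<in> mult_M S l" for x l
      using mult_M_add[OF that mult_m_in_mult_M[of 1]] by simp
    show "l * m \<le> x + 0" if "x \<in> mult_M S l" for x l
      using mult_M_ge that by simp
    show "int l \<le> int (b_sg S i) \<longleftrightarrow> w i \<in> int ` mult_M S l" for l i
    proof -
      obtain s where "s \<in> S" "w i = int s" using w_in by blast
      then show ?thesis using b[of i] mem_mult_M_iff[of s l] by auto
    qed
  qed (use m_pos mult_M_antimono_Suc finite_compl w_def in auto)
  also have "\<dots> \<longleftrightarrow> (\<forall>s\<in>S. sg_ord S (s + m) = sg_ord S s + 1)"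
    using sg_ord_add_m_iff by auto
  finally show ?thesis .
qed

end

section \<open>Ideals and numerical duplication\<close>

locale sg_duplication = numerical_sg +
  fixes E :: "nat set" and b :: nat
  assumes ideal: "semigroup_ideal S E" and zero_notin: "0 \<notin> E"
    and b_in: "b \<in> S" and odd_b: "odd b"
begin

lemma E_ne: "E \<noteq> {}" and E_sub: "e \<in> E \<Longrightarrow> e \<in> S"
  and E_add: "e \<in> E \<Longrightarrow> s \<in> S \<Longrightarrow> e + s \<in> E"
  using ideal by (auto simp: semigroup_ideal_def)

lemma E_plus_S: "E + S = E"
  using E_add zero_in by (force simp: set_plus_def)

lemma ideal_filtration_antimono: "l \<le> l' \<Longrightarrow> E + mult_M S l' \<subseteq> E + mult_M S l"
  using mult_M_antimono by (simp add: set_plus_mono2)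

text \<open>The order in \<open>E\<close> also counts the summand from \<open>E\<close>, hence the
  offset by one. As in \<open>S\<close>, the levels decrease and \<open>E + lM\<close> starts no
  earlier than \<open>l * m\<close>.\<close>

lemma mem_ideal_filtration_iff:
  assumes "e \<in> E"
  shows "e \<in> E + mult_M S l \<longleftrightarrow> l + 1 \<le> ord_ideal S E e"
proof -
  let ?A = "{l + 1 | l. e \<in> mult_M S l + E}"
  have fin: "finite ?A"
  proof (rule finite_subset[of _ "{..e + 1}"])
    have "l \<le> e" if *: "e \<in> mult_M S l + E" for l
    proof -
      obtain x y where "x \<in> mult_M S l" "e = x + y" using * unfolding set_plus_def by blast
      then have "l * m \<le> e" using mult_M_ge[of x l] by simp
      then show ?thesis using m_pos
        by (metis One_nat_def Suc_leI le_trans mult.right_neutral mult_le_mono2)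
    qed
    then show "?A \<subseteq> {..e + 1}" by auto
  qed simp
  have ne: "0 + 1 \<in> ?A" using assms E_plus_S by (force simp: add.commute[of S])
  have "Max ?A \<in> ?A" using Max_in[OF fin] ne by blast
  then obtain k where k: "Max ?A = k + 1" "e \<in> E + mult_M S k" by (auto simp: add.commute)
  have "l \<le> k" if "e \<in> E + mult_M S l"
    using Max_ge[OF fin, of "l + 1"] that k(1) by (auto simp: add.commute)
  moreover have "e \<in> E + mult_M S l" if "l \<le> k"
    using ideal_filtration_antimono[OF that] k(2) by blast
  ultimately show ?thesis unfolding ord_ideal_def k(1) by auto
qed

lemma cofinite_E: "finite (- E)"
proof -
  obtain e where e: "e \<in> E" using E_ne by blast
  obtain c where c: "\<And>n. n \<ge> c \<Longrightarrow> n \<in> S" using ex_conductor by blast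
  have "n \<in> E" if "n \<ge> e + c" for n
    using E_add[OF e c[of "n - e"]] that by simp
  then have "- E \<subseteq> {..e + c}" by (metis Compl_iff atMost_iff nat_le_linear subsetI)
  then show ?thesis using finite_subset by blast
qed

lemma a_eq_b_ideal_iff:
  "(\<forall>i<m. a_ideal S E i = int (b_ideal S E i)) \<longleftrightarrow>
    (\<forall>l. \<forall>e\<in>E. e + m \<in> E + mult_M S l \<longrightarrow> e \<in> E + mult_M S (l - 1))"
proof -
  \<comment> \<open>The index of \<open>F\<close> is the order in \<open>E\<close>. By truncated
    subtraction \<open>F 0\<close> and \<open>F 1\<close> both equal \<open>E\<close>.\<close>
  define F where "F l = E + mult_M S (l - 1)" for l
  have F0: "F 0 = E" by (simp add: F_def E_plus_S)
  define w where "w i = least_cong m (int ` E) i" for i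
  have ex: "\<exists>x\<in>int ` E. [x = int i] (mod int m)" for i
  proof -
    obtain c where c: "\<forall>n\<in>-E. n < c"
      using finite_nat_set_iff_bounded cofinite_E by blast
    have "c \<le> i + m * c" using m_pos by (simp add: trans_le_add2)
    then have "int (i + m * c) \<in> int ` E" using c by (metis Compl_iff image_eqI not_less)
    moreover have "[int (i + m * c) = int i] (mod int m)" by (simp add: cong_def)
    ultimately show ?thesis by blast
  qed
  have w_in: "w i \<in> int ` E" for i
    unfolding w_def by (rule least_cong_props(1)[of _ 0]) (use ex in auto)
  have shift: "x + m \<in> F (Suc l)" if x: "x \<in> F l" for x l
  proof -
    obtain e u where eu: "e \<in> E" "u \<in> mult_M S (l - 1)" "x = e + u"
      using x by (auto simp: F_def set_plus_def)
    have "u + m \<in> mult_M S (l - 1 + 1)"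
      using mult_M_add[OF eu(2) mult_m_in_mult_M[of 1]] by simp
    then have "u + m \<in> mult_M S l" using mult_M_antimono[of l "l - 1 + 1"] by fastforce
    then show ?thesis using eu by (auto simp: F_def set_plus_def add.assoc)
  qed
  \<comment> \<open>The right-hand side also admits \<open>l = 0\<close>. This adds nothing, since
    \<open>shift\<close> moves a witness for \<open>l\<close> to one for
    \<open>l + 1\<close>.\<close>
  have blow: "ideal_blowup S E = {z. \<exists>l. z + int (l * m) \<in> int ` F l}" (is "_ = ?B")
  proof (intro equalityI subsetI)
    fix z assume "z \<in> ?B"
    then obtain l x where x: "z + int (l * m) = int x" "x \<in> F l" by blast
    have "z + int (Suc l * m) = int (x + m)" using x(1) by (simp add: algebra_simps)
    then show "z \<in> ideal_blowup S E"
      unfolding ideal_blowup_eq using shift[OF x(2)] unfolding F_def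
      by (intro CollectI exI[of _ "Suc l"]) (metis One_nat_def diff_Suc_1 image_eqI le_add1 plus_1_eq_Suc)
  qed (auto simp: ideal_blowup_eq F_def)
  have "(\<forall>i<m. a_ideal S E i = int (b_ideal S E i)) \<longleftrightarrow>
      (\<forall>l. \<forall>x\<in>F 0. x + m \<in> F (Suc l) \<longrightarrow> x \<in> F l)"
    unfolding a_ideal_def Let_def blow w_def[symmetric]
  \<comment> \<open>Elements of \<open>E + (l - 1)M\<close> are at least \<open>(l - 1) m\<close>;
    the slack \<open>c = m\<close> makes up for the missing summand.\<close>
  proof (rule filtration_criterion[where c = m and F = F and m = m, OF m_pos])
    show "x + m \<in> F (Suc l)" if "x \<in> F l" for x l using that by (rule shift)
    show "F (Suc l) \<subseteq> F l" for l
      unfolding F_def by (rule ideal_filtration_antimono) simp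
    show "l * m \<le> x + m" if x: "x \<in> F l" for x l
    proof -
      obtain u e where "u \<in> mult_M S (l - 1)" "x = e + u"
        using x by (auto simp: F_def set_plus_def)
      then show ?thesis using mult_M_ge[of u "l - 1"] by (cases l) auto
    qed
    show "int l \<le> int (b_ideal S E i) \<longleftrightarrow> w i \<in> int ` F l" for l i
    proof -
      obtain e where e: "e \<in> E" "w i = int e" using w_in by blast
      have "b_ideal S E i = ord_ideal S E e"
        by (simp add: b_ideal_def w_def[symmetric] e(2))
      moreover have "1 \<le> ord_ideal S E e"
        using mem_ideal_filtration_iff[OF e(1), of 0] e(1) by (simp add: E_plus_S)
      ultimately show ?thesis
        using mem_ideal_filtration_iff[OF e(1), of "l - 1"] e(2) by (auto simp: F_def)
    qed
    show "w i = least_cong m (int ` F 0) i" for i by (simp add: w_def F0)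
    show "finite (- F 0)" using cofinite_E by (simp add: F0)
  qed
  then show ?thesis by (simp add: F0) (simp add: F_def)
qed

section \<open>Orders in the numerical duplication\<close>

abbreviation T :: "nat set" where "T \<equiv> duplication S b E"

lemma even_in_T: "2 * s \<in> T \<longleftrightarrow> s \<in> S"
  using odd_b by (auto simp: duplication_def) presburger

lemma odd_in_T: "2 * e + b \<in> T \<longleftrightarrow> e \<in> E"
  using odd_b by (auto simp: duplication_def) presburger

lemma T_cases:
  assumes "t \<in> T"
  obtains s where "s \<in> S" "t = 2 * s" | e where "e \<in> E" "t = 2 * e + b"
  using assms by (auto simp: duplication_def)

text \<open>Two odd elements of \<open>T\<close> add up to \<open>2 * (e + e' + b)\<close>;
  \<open>b \<in> S\<close> keeps this in the even half.\<close>

lemma E_add_b: "e \<in> E \<Longrightarrow> e' \<in> E \<Longrightarrow> e + e' + b \<in> S"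
  using E_sub add_in b_in by blast

lemma duplication_numerical_semigroup: "numerical_semigroup T"
proof -
  have "x + y \<in> T" if x: "x \<in> T" and y: "y \<in> T" for x y
    using x
  proof (cases rule: T_cases)
    case (1 s)
    show ?thesis using y
    proof (cases rule: T_cases)
      case (1 s')
      then show ?thesis using \<open>s \<in> S\<close> \<open>x = 2 * s\<close> even_in_T[of "s + s'"] add_in by simp
    next
      case (2 e)
      then show ?thesis using \<open>s \<in> S\<close> \<open>x = 2 * s\<close> odd_in_T[of "e + s"] E_add
        by (simp add: algebra_simps)
    qed
  next
    case (2 e)
    show ?thesis using y
    proof (cases rule: T_cases)
      case (1 s)
      then show ?thesis using \<open>e \<in> E\<close> \<open>x = 2 * e + b\<close> odd_in_T[of "e + s"] E_add
        by (simp add: algebra_simps)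
    next
      case (2 e')
      then show ?thesis using \<open>e \<in> E\<close> \<open>x = 2 * e + b\<close> even_in_T[of "e + e' + b"] E_add_b[of e e']
        by (simp add: algebra_simps)
    qed
  qed
  moreover have "finite (- T)"
  proof -
    obtain c where c: "\<forall>n\<in>-E. n < c"
      using finite_nat_set_iff_bounded cofinite_E by blast
    have "n \<in> T" if "n \<ge> 2 * c + b" for n
    proof (cases "even n")
      case True
      then obtain k where k: "n = 2 * k" by blast
      then have "k \<in> E" using that c by (metis Compl_iff add_leD1 mult_le_cancel1 not_less zero_less_numeral)
      then show ?thesis using E_sub even_in_T k by blast
    next
      case False
      then have "even (n - b)" using odd_b that by simp
      then obtain k where k: "n - b = 2 * k" by blast
      then have "c \<le> k" using that by linarith
      then have "k \<in> E" using c by (metis Compl_iff not_less)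
      moreover have "n = 2 * k + b" using k that by linarith
      ultimately show ?thesis using odd_in_T by blast
    qed
    then have "- T \<subseteq> {..2 * c + b}" by (metis Compl_iff atMost_iff nat_le_linear subsetI)
    then show ?thesis using finite_subset by blast
  qed
  ultimately show ?thesis
    using even_in_T[of 0] zero_in unfolding numerical_semigroup_def by auto
qed

sublocale T: numerical_sg T
  by unfold_locales (rule duplication_numerical_semigroup)

text \<open>As \<open>0 \<notin> E\<close>, an odd element \<open>2 * e + b\<close> has
  \<open>e \<ge> m\<close>, so it cannot undercut \<open>2 * m\<close>.\<close>

lemma duplication_multiplicity: "sg_multiplicity T = 2 * m"
  unfolding sg_multiplicity_def[of T]
proof (rule Least_equality)
  show "2 * m \<in> T \<and> 2 * m \<noteq> 0" using even_in_T m_in m_pos by simp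
next
  fix y assume y: "y \<in> T \<and> y \<noteq> 0"
  then have "y \<in> T" by simp
  then show "2 * m \<le> y"
  proof (cases rule: T_cases)
    case (1 s)
    then show ?thesis using y m_le by auto
  next
    case (2 e)
    then have "e \<noteq> 0" using zero_notin by metis
    then show ?thesis using 2 m_le[OF E_sub] by fastforce
  qed
qed

lemma double_in_mult_M: "s \<in> mult_M S l \<Longrightarrow> 2 * s \<in> mult_M T l"
proof (induction l arbitrary: s)
  case 0
  then show ?case by (simp add: even_in_T)
next
  case (Suc l)
  then obtain a y where "a \<in> S - {0}" "y \<in> mult_M S l" "s = a + y"
    using mult_M_Suc by blast
  then have "2 * a \<in> T - {0}" "2 * y \<in> mult_M T l" "2 * s = 2 * a + 2 * y"
    using Suc.IH by (auto simp: even_in_T)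
  then show ?case using T.mult_M_Suc by blast
qed

text \<open>Induction that peels off one summand. In the decisive case the odd elements
  \<open>2 * e + b\<close> and \<open>2 * (e' + u) + b\<close> add up to twice
  \<open>e + (e' + b) + u\<close>. Here \<open>e\<close> and \<open>e' + b\<close> are nonzero
  elements of \<open>S\<close>, so merging two odd summands loses no level.\<close>

lemma mult_M_duplication:
  "x \<in> mult_M T l \<Longrightarrow> (\<exists>s. x = 2 * s \<and> s \<in> mult_M S l) \<or>
    (\<exists>e\<in>E. \<exists>u\<in>mult_M S (l - 1). x = 2 * (e + u) + b)"
proof (induction l arbitrary: x)
  case 0
  then have "x \<in> T" by simp
  then show ?case
  proof (cases rule: T_cases)
    case (2 e)
    then show ?thesis using zero_in by (intro disjI2 bexI[of _ e] bexI[of _ 0]) auto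
  qed auto
next
  case (Suc l)
  then obtain a y where a: "a \<in> T" "a \<noteq> 0" and y: "y \<in> mult_M T l" and x: "x = a + y"
    using T.mult_M_Suc by blast
  \<comment> \<open>The appeal to antimonotonicity is for \<open>l = 0\<close>, where
    \<open>Suc (l - 1)\<close> is \<open>1\<close>.\<close>
  have *: "v + u \<in> mult_M S l" if "v \<in> S" "v \<noteq> 0" "u \<in> mult_M S (l - 1)" for u v
    using that mult_M_Suc[of "v + u" "l - 1"] mult_M_antimono[of l "Suc (l - 1)"] by fastforce
  from a(1) show ?case
  proof (cases rule: T_cases)
    case (1 s)
    then have s: "s \<in> S" "s \<noteq> 0" using a by auto
    from Suc.IH[OF y] show ?thesis
    proof (elim disjE exE bexE conjE)
      fix v assume "y = 2 * v" "v \<in> mult_M S l"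
      then show ?thesis using s mult_M_Suc[of "s + v" l] x 1(2)
        by (intro disjI1 exI[of _ "s + v"]) auto
    next
      fix e u assume "e \<in> E" "u \<in> mult_M S (l - 1)" "y = 2 * (e + u) + b"
      then show ?thesis using s x 1(2) *[of s u]
        by (intro disjI2 bexI[of _ e] bexI[of _ "s + u"]) auto
    qed
  next
    case (2 e)
    from Suc.IH[OF y] show ?thesis
    proof (elim disjE exE bexE conjE)
      fix v assume "y = 2 * v" "v \<in> mult_M S l"
      then show ?thesis using x 2
        by (intro disjI2 bexI[of _ e] bexI[of _ v]) auto
    next
      fix e' u assume y': "e' \<in> E" "u \<in> mult_M S (l - 1)" "y = 2 * (e' + u) + b"
      have nz: "e \<noteq> 0" "e' \<noteq> 0" using y'(1) 2(1) zero_notin by metis+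
      have "(e' + b) + u \<in> mult_M S l"
        using *[of "e' + b" u] y' nz E_sub add_in b_in by simp
      then have "e + ((e' + b) + u) \<in> mult_M S (Suc l)"
        using mult_M_Suc E_sub[OF 2(1)] nz by blast
      then show ?thesis using x y'(3) 2(2)
        by (intro disjI1 exI[of _ "e + ((e' + b) + u)"]) auto
    qed
  qed
qed

lemma double_mem_mult_M_iff: "2 * s \<in> mult_M T l \<longleftrightarrow> s \<in> mult_M S l"
proof
  assume "2 * s \<in> mult_M T l"
  from mult_M_duplication[OF this] show "s \<in> mult_M S l"
    using odd_b
    by (elim disjE exE bexE) (auto, presburger)
qed (rule double_in_mult_M)

text \<open>The part from \<open>E\<close> becomes one odd summand and the part from
  \<open>lM\<close> is doubled, which accounts for the shift by one.\<close>

lemma odd_mem_mult_M_iff: "2 * e + b \<in> mult_M T (Suc l) \<longleftrightarrow> e \<in> E + mult_M S l"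
proof
  assume "2 * e + b \<in> mult_M T (Suc l)"
  from mult_M_duplication[OF this] show "e \<in> E + mult_M S l"
  proof (elim disjE exE bexE conjE)
    fix s assume "2 * e + b = 2 * s"
    then show ?thesis using odd_b by presburger
  next
    fix e' u assume eu: "e' \<in> E" "u \<in> mult_M S (Suc l - 1)" "2 * e + b = 2 * (e' + u) + b"
    have "e = e' + u" using eu(3) by simp
    then show ?thesis using eu by (auto simp: set_plus_def)
  qed
next
  assume "e \<in> E + mult_M S l"
  then obtain e' u where eu: "e' \<in> E" "u \<in> mult_M S l" "e = e' + u"
    by (auto simp: set_plus_def)
  have "2 * e' + b \<in> T - {0}" using eu(1) odd_in_T odd_b by (auto elim: oddE)
  moreover have "2 * e + b = (2 * e' + b) + 2 * u" using eu by simp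
  ultimately show "2 * e + b \<in> mult_M T (Suc l)"
    using T.mult_M_Suc double_in_mult_M[OF eu(2)] by blast
qed

text \<open>Adding \<open>sg_multiplicity T = 2 * m\<close> in \<open>T\<close> means adding
  \<open>m\<close> to \<open>s\<close> or to \<open>e\<close>. The even half therefore gives the
  criterion for \<open>S\<close> and the odd half the one for \<open>E\<close>.\<close>

lemma duplication_regular_iff:
  "(\<forall>t\<in>T. sg_ord T (t + sg_multiplicity T) = sg_ord T t + 1) \<longleftrightarrow>
    (\<forall>i<m. a_sg S i = int (b_sg S i) \<and> a_ideal S E i = int (b_ideal S E i))"
proof -
  let ?P = "\<lambda>t. \<forall>l. t + 2 * m \<in> mult_M T (Suc l) \<longrightarrow> t \<in> mult_M T l"
  have even: "?P (2 * s) \<longleftrightarrow> sg_ord S (s + m) = sg_ord S s + 1" if "s \<in> S" for s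
    using sg_ord_add_m_iff[OF that] double_mem_mult_M_iff[of "s + m"] double_mem_mult_M_iff[of s]
    by simp
  have odd: "?P (2 * e + b) \<longleftrightarrow> (\<forall>l. e + m \<in> E + mult_M S l \<longrightarrow> e \<in> E + mult_M S (l - 1))"
    if "e \<in> E" for e
  proof -
    have "2 * e + b \<in> mult_M T l \<longleftrightarrow> e \<in> E + mult_M S (l - 1)" for l
      using that by (cases l) (auto simp: odd_mem_mult_M_iff odd_in_T E_plus_S)
    then show ?thesis
      using odd_mem_mult_M_iff[of "e + m"] by (simp add: algebra_simps)
  qed
  have "(\<forall>t\<in>T. sg_ord T (t + sg_multiplicity T) = sg_ord T t + 1) \<longleftrightarrow> (\<forall>t\<in>T. ?P t)"
    using T.sg_ord_add_m_iff by (simp add: duplication_multiplicity)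
  also have "\<dots> \<longleftrightarrow> (\<forall>s\<in>S. ?P (2 * s)) \<and> (\<forall>e\<in>E. ?P (2 * e + b))"
    by (auto simp: even_in_T odd_in_T elim!: T_cases)
  also have "\<dots> \<longleftrightarrow> (\<forall>s\<in>S. sg_ord S (s + m) = sg_ord S s + 1) \<and>
     (\<forall>e\<in>E. \<forall>l. e + m \<in> E + mult_M S l \<longrightarrow> e \<in> E + mult_M S (l - 1))"
    using even odd by simp
  also have "\<dots> \<longleftrightarrow>
    (\<forall>i<m. a_sg S i = int (b_sg S i)) \<and> (\<forall>i<m. a_ideal S E i = int (b_ideal S E i))"
    using a_eq_b_sg_iff a_eq_b_ideal_iff by blast
  finally show ?thesis by blast
qed

end

section \<open>Nilpotent thickenings of a polynomial ring\<close>

text \<open>Division with remainder by an element of least degree. The closure properties are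
  spelled out because the sets in question are preimages of ideals under
  \<open>\<phi>\<close>.\<close>

lemma poly_ideal_generator:
  fixes I :: "'k::field poly set"
  assumes "0 \<in> I" and add: "\<And>p q. p \<in> I \<Longrightarrow> q \<in> I \<Longrightarrow> p + q \<in> I"
    and mult: "\<And>p q. p \<in> I \<Longrightarrow> p * q \<in> I"
  shows "\<exists>d. \<forall>p. p \<in> I \<longleftrightarrow> d dvd p"
proof (cases "I = {0}")
  case True
  then show ?thesis by (intro exI[of _ 0]) auto
next
  case False
  then obtain d0 where "d0 \<in> I \<and> d0 \<noteq> 0" using assms(1) by blast
  obtain d where d: "d \<in> I" "d \<noteq> 0"
    and min: "\<And>p. p \<in> I \<Longrightarrow> p \<noteq> 0 \<Longrightarrow> degree d \<le> degree p"
    using ex_has_least_nat[of "\<lambda>d. d \<in> I \<and> d \<noteq> 0" d0 degree] \<open>d0 \<in> I \<and> d0 \<noteq> 0\<close> by blast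
  have "d dvd p" if p: "p \<in> I" for p
  proof -
    have "p mod d = p + d * (- (p div d))"
      by (simp add: minus_div_mult_eq_mod[symmetric] algebra_simps)
    then have "p mod d \<in> I" using add[OF p mult[OF d(1), of "- (p div d)"]] by simp
    then have "p mod d = 0"
      using min[of "p mod d"] degree_mod_less[OF d(2), of p] by fastforce
    then show ?thesis by auto
  qed
  moreover have "p \<in> I" if "d dvd p" for p
    using that mult[OF d(1)] by (auto simp: dvd_def)
  ultimately show ?thesis by blast
qed

text \<open>With \<open>b\<close> nilpotent, this puts a power of \<open>a\<close> into
  \<open>I\<close>.\<close>

lemma (in cring) ideal_pow_diff:
  assumes I: "ideal I R" and "a \<in> carrier R" "b \<in> carrier R" "a \<ominus> b \<in> I"
  shows "a [^] n \<ominus> b [^] (n::nat) \<in> I"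
proof (induction n)
  case 0
  then show ?case using I by (simp add: r_neg minus_eq additive_subgroup.zero_closed ideal.axioms(1))
next
  case (Suc n)
  have "a [^] Suc n \<ominus> b [^] Suc n = (a [^] n \<ominus> b [^] n) \<otimes> a \<oplus> b [^] n \<otimes> (a \<ominus> b)"
  proof -
    have "x \<otimes> a \<ominus> y \<otimes> b = (x \<ominus> y) \<otimes> a \<oplus> y \<otimes> (a \<ominus> b)"
      if "x \<in> carrier R" "y \<in> carrier R" for x y
      using assms that by algebra
    then show ?thesis using assms by simp
  qed
  moreover have "(a [^] n \<ominus> b [^] n) \<otimes> a \<in> I" "b [^] n \<otimes> (a \<ominus> b) \<in> I"
    using Suc assms ideal.I_r_closed[OF I] ideal.I_l_closed[OF I] by auto
  ultimately show ?case using additive_subgroup.a_closed[OF ideal.axioms(1)[OF I]] by metis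
qed

lemma (in ring) ideal_minus_closed:
  assumes "ideal I R" "a \<in> I" "b \<in> I"
  shows "a \<ominus> b \<in> I"
  using assms unfolding minus_eq
  by (intro additive_subgroup.a_closed[OF ideal.axioms(1)]
      additive_subgroup.a_inv_closed[OF ideal.axioms(1)])

lemma (in ring) genideal_empty: "Idl {} = {\<zero>}"
proof -
  have "Idl {} \<subseteq> {\<zero>}" using zeroideal unfolding genideal_def by blast
  moreover have "\<zero> \<in> Idl {}"
    using genideal_ideal[of "{}"] by (simp add: additive_subgroup.zero_closed ideal.axioms(1))
  ultimately show ?thesis by blast
qed

text \<open>\<open>\<phi>\<close> embeds \<open>k[x]\<close>, and \<open>\<rho>\<close> retracts
  onto it with a nil kernel. For the graded ring, \<open>\<phi>\<close> sends \<open>x\<close> to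
  the initial form of \<open>t^m\<close>.\<close>

locale poly_retract = cring R for R (structure) +
  fixes \<phi> :: "'k::field poly \<Rightarrow> 'a" and \<rho> :: "'a \<Rightarrow> 'k poly"
  assumes \<phi>_closed [simp]: "\<phi> p \<in> carrier R"
    and \<phi>_add: "\<phi> (p + q) = \<phi> p \<oplus> \<phi> q"
    and \<phi>_mult: "\<phi> (p * q) = \<phi> p \<otimes> \<phi> q"
    and \<phi>_one: "\<phi> 1 = \<one>"
    and \<rho>_add: "f \<in> carrier R \<Longrightarrow> g \<in> carrier R \<Longrightarrow> \<rho> (f \<oplus> g) = \<rho> f + \<rho> g"
    and \<rho>_mult: "f \<in> carrier R \<Longrightarrow> g \<in> carrier R \<Longrightarrow> \<rho> (f \<otimes> g) = \<rho> f * \<rho> g"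
    and \<rho>_\<phi> [simp]: "\<rho> (\<phi> p) = p"
    and nilpotent: "f \<in> carrier R \<Longrightarrow> \<rho> f = 0 \<Longrightarrow> \<exists>n::nat. f [^] n = \<zero>"
begin

lemma \<phi>_zero: "\<phi> 0 = \<zero>"
proof -
  have "\<phi> 0 \<oplus> \<phi> 0 = \<phi> 0 \<oplus> \<zero>" using \<phi>_add[of 0 0] by simp
  then show ?thesis by (simp only: add.l_cancel zero_closed \<phi>_closed)
qed

lemma \<phi>_pow: "\<phi> (p ^ n) = \<phi> p [^] n"
  by (induction n) (simp_all add: \<phi>_one \<phi>_mult m_comm)

lemma \<rho>_zero [simp]: "\<rho> \<zero> = 0"
  using \<rho>_\<phi>[of 0] \<phi>_zero by simp

lemma \<rho>_one [simp]: "\<rho> \<one> = 1"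
  using \<rho>_\<phi>[of 1] \<phi>_one by simp

lemma \<rho>_uminus: "f \<in> carrier R \<Longrightarrow> \<rho> (\<ominus> f) = - \<rho> f"
  using \<rho>_add[of "\<ominus> f" f] by (simp add: l_neg eq_neg_iff_add_eq_0)

lemma \<rho>_minus: "f \<in> carrier R \<Longrightarrow> g \<in> carrier R \<Longrightarrow> \<rho> (f \<ominus> g) = \<rho> f - \<rho> g"
  by (simp add: minus_eq \<rho>_add \<rho>_uminus)

lemma one_not_zero: "\<one> \<noteq> \<zero>"
  using \<rho>_zero \<rho>_one by force

lemma \<rho>_vimage_ideal:
  assumes "\<And>p q. p \<in> I \<Longrightarrow> q \<in> I \<Longrightarrow> p + q \<in> I" "\<And>p q. p \<in> I \<Longrightarrow> q * p \<in> I" "0 \<in> I"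
  shows "ideal {f \<in> carrier R. \<rho> f \<in> I} R"
proof (rule idealI)
  show "subgroup {f \<in> carrier R. \<rho> f \<in> I} (add_monoid R)"
  proof
    fix x assume "x \<in> {f \<in> carrier R. \<rho> f \<in> I}"
    then have "\<ominus> x \<in> carrier R" "\<rho> (\<ominus> x) \<in> I"
      using assms(2)[of "\<rho> x" "-1"] by (auto simp: \<rho>_uminus)
    then show "inv\<^bsub>add_monoid R\<^esub> x \<in> {f \<in> carrier R. \<rho> f \<in> I}"
      by (simp add: a_inv_def)
  qed (use assms in \<open>auto simp: \<rho>_add\<close>)
qed (use assms in \<open>auto simp: \<rho>_mult mult.commute ring_axioms\<close>)

text \<open>The kernel of \<open>\<rho>\<close>, and below it the preimage of the ideal generated by
  \<open>x\<close>. Both are phrased as membership in a set to match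
  \<open>\<rho>_vimage_ideal\<close>.\<close>

abbreviation K where "K \<equiv> {f \<in> carrier R. \<rho> f \<in> {0}}"
abbreviation P0 where "P0 \<equiv> {f \<in> carrier R. \<rho> f \<in> {p. coeff p 0 = 0}}"

lemma K_prime: "primeideal K R"
proof (rule primeidealI)
  show "ideal K R" by (rule \<rho>_vimage_ideal) auto
  have "\<one> \<notin> K" by simp
  then show "carrier R \<noteq> K" using one_closed by blast
qed (auto simp: \<rho>_mult is_cring)

lemma P0_ideal: "ideal P0 R"
  by (rule \<rho>_vimage_ideal) (auto simp: coeff_mult)

lemma P0_maximal: "maximalideal P0 R"
proof (rule maximalidealI[OF P0_ideal])
  have "\<one> \<notin> P0" by simp
  then show "carrier R \<noteq> P0" using one_closed by blast
next
  fix J assume J: "ideal J R" "P0 \<subseteq> J" "J \<subseteq> carrier R"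
  show "J = P0 \<or> J = carrier R"
  proof (cases "J = P0")
    case False
    then obtain f where f: "f \<in> J" "f \<notin> P0" using J by blast
    have fc: "f \<in> carrier R" using f J by blast
    define a where "a = coeff (\<rho> f) 0"
    have a: "a \<noteq> 0" using f fc by (simp add: a_def)
    \<comment> \<open>Modulo \<open>P0\<close>, \<open>f\<close> is the nonzero constant
      \<open>a\<close>, so \<open>J\<close> contains a unit.\<close>
    have "f \<ominus> \<phi> [:a:] \<in> P0" using fc by (simp add: \<rho>_minus a_def)
    then have "f \<ominus> (f \<ominus> \<phi> [:a:]) \<in> J"
      using f J(2) ideal_minus_closed[OF J(1)] by blast
    moreover have "f \<ominus> (f \<ominus> \<phi> [:a:]) = \<phi> [:a:]"
    proof -
      have "f \<ominus> (f \<ominus> x) = x" if "x \<in> carrier R" for x using fc that by algebra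
      then show ?thesis by simp
    qed
    ultimately have "\<phi> [:a:] \<otimes> \<phi> [:1 / a:] \<in> J" using ideal.I_r_closed[OF J(1)] by simp
    then have "\<one> \<in> J" using a by (simp add: \<phi>_mult[symmetric] \<phi>_one[symmetric] pCons_one)
    then show ?thesis using ideal.one_imp_carrier[OF J(1)] by blast
  qed simp
qed

section \<open>Prime ideals and their heights\<close>

lemma K_subset_prime:
  assumes P: "primeideal P R"
  shows "K \<subseteq> P"
proof
  fix f assume f: "f \<in> K"
  interpret P: primeideal P R by fact
  have pow: "f \<in> P" if "f [^] n \<in> P" for n :: nat
    using that
  proof (induction n)
    case 0
    then show ?case using P.one_imp_carrier P.I_notcarr by simp
  next
    case (Suc n)
    then show ?case using f P.I_prime[of "f [^] n" f] by auto
  qed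
  \<comment> \<open>Elements of \<open>K\<close> are nilpotent, and primes contain all
    nilpotents.\<close>
  obtain n :: nat where "f [^] n = \<zero>" using nilpotent f by auto
  then show "f \<in> P" using pow by (metis P.zero_closed)
qed

lemma diff_in_K: "f \<in> carrier R \<Longrightarrow> f \<ominus> \<phi> (\<rho> f) \<in> K"
  by (simp add: \<rho>_minus)

text \<open>\<open>f\<close> and \<open>\<phi> (\<rho> f)\<close> differ by an element of
  \<open>K\<close>, which lies in every prime. A prime is thus determined by the polynomials it
  contains.\<close>

lemma prime_mem_iff:
  assumes P: "primeideal P R" and f: "f \<in> carrier R"
  shows "f \<in> P \<longleftrightarrow> \<phi> (\<rho> f) \<in> P"
proof -
  interpret P: primeideal P R by fact
  have d: "f \<ominus> \<phi> (\<rho> f) \<in> P" using K_subset_prime[OF P] diff_in_K[OF f] by blast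
  have 1: "(f \<ominus> x) \<oplus> x = f" and 2: "f \<ominus> (f \<ominus> x) = x" if "x \<in> carrier R" for x
    using f that by algebra+
  show ?thesis
  proof
    assume "f \<in> P"
    then show "\<phi> (\<rho> f) \<in> P"
      using ideal_minus_closed[OF P.ideal_axioms _ d, of f] 2[of "\<phi> (\<rho> f)"] by simp
  next
    assume "\<phi> (\<rho> f) \<in> P"
    then show "f \<in> P"
      using P.a_closed[OF d, of "\<phi> (\<rho> f)"] 1[of "\<phi> (\<rho> f)"] by simp
  qed
qed

lemma ideal_generator:
  assumes "ideal P R"
  obtains d where "\<And>p. \<phi> p \<in> P \<longleftrightarrow> d dvd p"
proof -
  interpret P: ideal P R by fact
  have "\<exists>d. \<forall>p. p \<in> {p. \<phi> p \<in> P} \<longleftrightarrow> d dvd p"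
    by (rule poly_ideal_generator) (auto simp: \<phi>_zero \<phi>_add \<phi>_mult P.I_r_closed)
  then show thesis using that by auto
qed

lemma prime_generator_not_unit:
  assumes P: "primeideal P R" and d: "\<And>p. \<phi> p \<in> P \<longleftrightarrow> d dvd p"
  shows "\<not> d dvd 1"
proof
  interpret P: primeideal P R by fact
  assume "d dvd 1"
  then have "\<one> \<in> P" using d[of 1] \<phi>_one by simp
  then show False using P.one_imp_carrier P.I_notcarr by simp
qed

lemma prime_generator_nonzero:
  assumes P: "primeideal P R" and d: "\<And>p. \<phi> p \<in> P \<longleftrightarrow> d dvd p" and "P \<noteq> K"
  shows "d \<noteq> 0"
proof
  assume "d = 0"
  then have "f \<in> K" if "f \<in> P" for f
    using prime_mem_iff[OF P, of f] that d[of "\<rho> f"] ideal.Icarr[OF primeideal.axioms(1)[OF P]]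
    by auto
  then show False using K_subset_prime[OF P] \<open>P \<noteq> K\<close> by blast
qed

text \<open>This reflects that nonzero primes of \<open>k[x]\<close> are maximal. For generators
  with \<open>q = d * c\<close>, primality of \<open>Q\<close> puts \<open>d\<close> or
  \<open>c\<close> into the multiples of \<open>q\<close>; the second alternative would make
  \<open>d\<close> a unit.\<close>

lemma primes_above_K:
  assumes Q: "primeideal Q R" and P: "primeideal P R" and "Q \<subseteq> P" "Q \<noteq> K"
  shows "Q = P"
proof -
  interpret Q: primeideal Q R by fact
  obtain d where d: "\<And>p. \<phi> p \<in> P \<longleftrightarrow> d dvd p"
    using ideal_generator primeideal.axioms(1)[OF P] by blast
  obtain q where q: "\<And>p. \<phi> p \<in> Q \<longleftrightarrow> q dvd p"
    using ideal_generator Q.ideal_axioms by blast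
  have q0: "q \<noteq> 0" by (rule prime_generator_nonzero[OF Q q \<open>Q \<noteq> K\<close>])
  have "d dvd q" using d[of q] q[of q] \<open>Q \<subseteq> P\<close> by auto
  then obtain c where c: "q = d * c" by (auto simp: dvd_def)
  have "\<phi> d \<otimes> \<phi> c \<in> Q" using q[of q] c by (simp add: \<phi>_mult)
  then consider "\<phi> d \<in> Q" | "\<phi> c \<in> Q" using Q.I_prime[of "\<phi> d" "\<phi> c"] by auto
  then have "q dvd d"
  proof cases
    case 1
    then show ?thesis using q[of d] by simp
  next
    case 2
    then obtain k where "c = q * k" using q[of c] by (auto simp: dvd_def)
    then have "q * 1 = q * (d * k)" using c by (metis mult.left_commute mult.right_neutral)
    then have "1 = d * k" using q0 mult_left_cancel[of q 1 "d * k"] by blast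
    then have "d dvd 1" by (rule dvdI)
    then show ?thesis using prime_generator_not_unit[OF P d] by simp
  qed
  have "f \<in> Q" if "f \<in> P" for f
  proof -
    have f: "f \<in> carrier R" using ideal.Icarr[OF primeideal.axioms(1)[OF P] that] .
    have "d dvd \<rho> f" using prime_mem_iff[OF P f] that d by simp
    then show ?thesis using prime_mem_iff[OF Q f] q dvd_trans[OF \<open>q dvd d\<close>] by simp
  qed
  then show ?thesis using \<open>Q \<subseteq> P\<close> by blast
qed

text \<open>\<open>P0\<close> lies strictly above \<open>K\<close>, since it contains
  \<open>\<phi> [:0, 1:]\<close>.\<close>

lemma maximal_ne_K:
  assumes P: "maximalideal P R"
  shows "P \<noteq> K"
proof
  assume eq: "P = K"
  have "\<phi> [:0, 1:] \<in> P0" "\<phi> [:0, 1:] \<notin> K" by auto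
  moreover have "K \<subseteq> P0" by auto
  ultimately have "P0 = carrier R"
    using maximalideal.I_maximal[OF P P0_ideal] eq by blast
  then show False using maximalideal.I_notcarr[OF P0_maximal] by simp
qed

text \<open>\<open>K\<close> lies below every prime, and by \<open>primes_above_K\<close> nothing
  fits strictly between \<open>K\<close> and another prime, so \<open>K \<subset> P\<close> is a
  longest chain.\<close>

lemma prime_height_maximal:
  assumes P: "maximalideal P R"
  shows "prime_height R P = 1"
proof (rule antisym)
  have Pp: "primeideal P R" using maximalideal_prime[OF P] .
  show "prime_height R P \<le> 1"
    unfolding prime_height_def
  proof (rule Sup_least, clarify)
    fix n and p :: "nat \<Rightarrow> 'a set"
    assume p: "\<forall>i\<le>n. primeideal (p i) R" "\<forall>i<n. p i \<subset> p (Suc i)" "P = p n"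
    show "enat n \<le> 1"
    proof (rule ccontr)
      assume "\<not> enat n \<le> 1"
      then obtain k where k: "n = Suc (Suc k)" by (cases n; cases "n - 1") (auto simp: one_enat_def)
      have "p k \<subset> p (Suc k)" "p (Suc k) \<subset> p n" using p(2) k by auto
      moreover have "K \<subseteq> p k" using K_subset_prime p(1) k by simp
      moreover have "primeideal (p (Suc k)) R" "primeideal (p n) R" using p(1) k by auto
      ultimately show False using primes_above_K[of "p (Suc k)" "p n"] by blast
    qed
  qed
  have "K \<subset> P" using K_subset_prime[OF Pp] maximal_ne_K[OF P] by blast
  then have "(\<forall>i\<le>1. primeideal ((if i = 0 then K else P)) R) \<and>
      (\<forall>i<1::nat. (if i = 0 then K else P) \<subset> (if Suc i = 0 then K else P)) \<and>
      (if (1::nat) = 0 then K else P) = P"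
    using K_prime Pp by simp
  then have "\<exists>p :: nat \<Rightarrow> 'a set. (\<forall>i\<le>1. primeideal (p i) R) \<and> (\<forall>i<1. p i \<subset> p (Suc i)) \<and> p 1 = P"
    by (intro exI[of _ "\<lambda>i. if i = 0 then K else P"])
  then show "1 \<le> prime_height R P"
    unfolding prime_height_def one_enat_def by (intro Sup_upper) blast
qed

section \<open>Depth at the maximal ideals\<close>

lemma regular_sequence_hd:
  assumes "regular_sequence R xs" "xs \<noteq> []" "r \<in> carrier R" "r \<otimes> xs ! 0 = \<zero>"
  shows "r = \<zero>"
  using assms unfolding regular_sequence_def by (force simp: genideal_empty)

text \<open>\<open>P0\<close> has height 1, but depth 0. Any \<open>h\<close> in \<open>P0\<close>
  is a multiple of \<open>\<phi> [:0, 1:]\<close> plus a nilpotent \<open>\<nu>\<close>. If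
  \<open>\<nu> ^ k\<close> is the last power of \<open>\<nu>\<close> not killing \<open>f\<close>,
  then \<open>f \<nu> ^ k\<close> is nonzero and annihilates \<open>h\<close>.\<close>

lemma not_cohen_macaulay:
  assumes f: "f \<in> carrier R" "f \<noteq> \<zero>" "f \<otimes> \<phi> [:0, 1:] = \<zero>"
  shows "\<not> cohen_macaulay R"
proof
  assume "cohen_macaulay R"
  then have "ideal_depth R P0 = 1"
    using P0_maximal prime_height_maximal by (simp only: cohen_macaulay_def)
  moreover have "xs = []" if xs: "regular_sequence R xs" "set xs \<subseteq> P0" for xs
  proof (rule ccontr)
    assume ne: "xs \<noteq> []"
    define h where "h = xs ! 0"
    have "h \<in> set xs" using ne by (simp add: h_def)
    then have h: "h \<in> P0" using xs(2) by blast
    obtain q where q: "\<rho> h = [:0, 1:] * q"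
    proof (cases "\<rho> h" rule: pCons_cases)
      case (pCons a q)
      then show thesis using h that[of q] by auto
    qed
    define \<nu> where "\<nu> = h \<ominus> \<phi> (\<rho> h)"
    have \<nu>: "\<nu> \<in> carrier R" "\<rho> \<nu> = 0" using h diff_in_K[of h] by (auto simp: \<nu>_def)
    have h_eq: "h = \<phi> [:0, 1:] \<otimes> \<phi> q \<oplus> \<nu>"
    proof -
      have "h = x \<oplus> (h \<ominus> x)" if "x \<in> carrier R" for x
      proof -
        have "h \<in> carrier R" using h by simp
        then show ?thesis using that by algebra
      qed
      from this[of "\<phi> (\<rho> h)"] show ?thesis unfolding \<nu>_def \<phi>_mult[symmetric] q[symmetric] by simp
    qed
    obtain n0 :: nat where n0: "\<nu> [^] n0 = \<zero>" using nilpotent \<nu> by blast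
    define n where "n = (LEAST n::nat. f \<otimes> \<nu> [^] n = \<zero>)"
    have n: "f \<otimes> \<nu> [^] n = \<zero>"
      unfolding n_def by (rule LeastI[of _ n0]) (simp add: n0 f)
    obtain k where k: "n = Suc k" using n f by (cases n) auto
    define w where "w = f \<otimes> \<nu> [^] k"
    have w: "w \<in> carrier R" "w \<noteq> \<zero>"
      using f \<nu> not_less_Least[of k "\<lambda>n. f \<otimes> \<nu> [^] n = \<zero>"] k by (auto simp: w_def n_def)
    have "w \<otimes> \<nu> = \<zero>" using n k f \<nu> by (simp add: w_def m_assoc)
    moreover have "w \<otimes> (\<phi> [:0, 1:] \<otimes> \<phi> q) = (f \<otimes> \<phi> [:0, 1:]) \<otimes> (\<nu> [^] k \<otimes> \<phi> q)"
    proof -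
      have "(f \<otimes> v) \<otimes> (x \<otimes> y) = (f \<otimes> x) \<otimes> (v \<otimes> y)"
        if "v \<in> carrier R" "x \<in> carrier R" "y \<in> carrier R" for v x y
        using f that by algebra
      then show ?thesis using \<nu> by (simp add: w_def)
    qed
    ultimately have "w \<otimes> h = \<zero>"
      unfolding h_eq using w f \<nu> by (simp add: r_distr)
    then show False using regular_sequence_hd[OF xs(1) ne w(1)] w(2) by (simp add: h_def)
  qed
  then have "ideal_depth R P0 \<le> 0"
    unfolding ideal_depth_def by (intro Sup_least) (auto simp: zero_enat_def)
  ultimately show False by simp
qed

text \<open>For a generator \<open>d\<close> of the polynomials in \<open>P\<close>,
  \<open>\<phi> d\<close> is a regular sequence. Suppose \<open>f, g\<close> began a longer one, and
  let \<open>c\<close> generate the polynomials in the ideal of \<open>f\<close>. Then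
  \<open>c = d * c'\<close>, and some power of \<open>g\<close> is a multiple of
  \<open>\<phi> d\<close>, so \<open>\<phi> c'\<close> times this power lies in the ideal of
  \<open>f\<close>. By regularity of \<open>g\<close> so does \<open>\<phi> c'\<close>; hence
  \<open>c\<close> divides \<open>c'\<close> and \<open>d\<close> is a unit.\<close>

lemma depth_maximal:
  assumes P: "maximalideal P R"
    and reg: "\<And>p f. p \<noteq> 0 \<Longrightarrow> f \<in> carrier R \<Longrightarrow> f \<otimes> \<phi> p = \<zero> \<Longrightarrow> f = \<zero>"
  shows "ideal_depth R P = 1"
proof (rule antisym)
  have Pp: "primeideal P R" using maximalideal_prime[OF P] .
  interpret P: primeideal P R by (rule Pp)
  obtain d where d: "\<And>p. \<phi> p \<in> P \<longleftrightarrow> d dvd p"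
    using ideal_generator P.ideal_axioms by blast
  have d0: "d \<noteq> 0" by (rule prime_generator_nonzero[OF Pp d maximal_ne_K[OF P]])
  have "\<phi> d \<in> P" using d by simp
  have "Idl {\<phi> d} \<subseteq> P" using genideal_minimal[OF P.ideal_axioms] \<open>\<phi> d \<in> P\<close> by simp
  then have "Idl {\<phi> d} \<noteq> carrier R" using P.I_notcarr P.a_subset by blast
  then have "regular_sequence R [\<phi> d]"
    unfolding regular_sequence_def using reg[OF d0] by (simp add: genideal_empty)
  then show "1 \<le> ideal_depth R P"
    unfolding ideal_depth_def one_enat_def using \<open>\<phi> d \<in> P\<close>
    by (intro Sup_upper CollectI exI[of _ "[\<phi> d]"]) simp
  show "ideal_depth R P \<le> 1"
    unfolding ideal_depth_def
  proof (rule Sup_least, clarify)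
    fix xs assume xs: "regular_sequence R xs" "set xs \<subseteq> P"
    show "enat (length xs) \<le> 1"
    proof (rule ccontr)
      assume "\<not> enat (length xs) \<le> 1"
      then have len: "length xs \<ge> 2" by (simp add: one_enat_def)
      define f where "f = xs ! 0"
      define g where "g = xs ! 1"
      have "0 < length xs" "1 < length xs" using len by linarith+
      then have "f \<in> set xs" "g \<in> set xs" unfolding f_def g_def using nth_mem by blast+
      then have fP: "f \<in> P" and gP: "g \<in> P" using xs(2) by auto
      have fc: "f \<in> carrier R" and gc: "g \<in> carrier R" using fP gP P.Icarr by auto
      let ?F = "Idl {f}"
      have F: "ideal ?F R" using fc by (simp add: genideal_ideal)
      interpret F: ideal ?F R by (rule F)
      have fF: "f \<in> ?F" using genideal_self'[OF fc] .
      have FP: "?F \<subseteq> P" using genideal_minimal[OF P.ideal_axioms] fP by simp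
      have take1: "set (take 1 xs) = {f}" using len by (cases xs) (auto simp: f_def)
      have greg: "r \<in> ?F" if "r \<in> carrier R" "r \<otimes> g \<in> ?F" for r
        using xs(1) that len unfolding regular_sequence_def g_def take1[symmetric]
        by (metis Suc_1 Suc_le_lessD)
      have gpow: "r \<in> ?F" if "r \<in> carrier R" "r \<otimes> g [^] n \<in> ?F" for r and n :: nat
        using that
      proof (induction n)
        case (Suc n)
        then have "(r \<otimes> g [^] n) \<otimes> g \<in> ?F" using gc by (simp add: m_assoc)
        then show ?case using Suc greg[of "r \<otimes> g [^] n"] gc by simp
      qed simp
      have xs_ne: "xs \<noteq> []" using len by auto
      have freg: "r = \<zero>" if "r \<in> carrier R" "r \<otimes> f [^] n = \<zero>" for r and n :: nat
        using that
      proof (induction n)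
        case (Suc n)
        then have "(r \<otimes> f [^] n) \<otimes> f = \<zero>" using fc by (simp add: m_assoc)
        then show ?case using Suc regular_sequence_hd[OF xs(1) xs_ne, of "r \<otimes> f [^] n"] fc
          by (simp add: f_def)
      qed simp
      \<comment> \<open>Otherwise \<open>f\<close> is nilpotent, although it is a
        nonzerodivisor.\<close>
      have \<rho>f: "\<rho> f \<noteq> 0"
      proof
        assume "\<rho> f = 0"
        then obtain n :: nat where "f [^] n = \<zero>" using nilpotent fc by blast
        then have "\<one> = \<zero>" using freg[of \<one> n] fc by simp
        then show False using one_not_zero by simp
      qed
      obtain c where c: "\<And>p. \<phi> p \<in> ?F \<longleftrightarrow> c dvd p" using ideal_generator F by blast
      \<comment> \<open>\<open>f\<close> is \<open>\<phi> (\<rho> f)\<close> minus a nilpotent, so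
        the ideal of \<open>f\<close> contains a power of \<open>\<phi> (\<rho> f)\<close>.\<close>
      have "c \<noteq> 0"
      proof -
        let ?\<nu> = "\<phi> (\<rho> f) \<ominus> f"
        have \<nu>: "?\<nu> \<in> carrier R" "\<rho> ?\<nu> = 0" using fc by (auto simp: \<rho>_minus)
        then obtain n :: nat where n: "?\<nu> [^] n = \<zero>" using nilpotent by blast
        have "\<phi> (\<rho> f) \<ominus> ?\<nu> = f"
        proof -
          have "x \<ominus> (x \<ominus> f) = f" if "x \<in> carrier R" for x using fc that by algebra
          then show ?thesis by simp
        qed
        then have "\<phi> (\<rho> f) [^] n \<ominus> ?\<nu> [^] n \<in> ?F"
          using ideal_pow_diff[OF F, of "\<phi> (\<rho> f)" ?\<nu> n] \<nu> fF by simp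
        then have "\<phi> (\<rho> f ^ n) \<in> ?F" unfolding n \<phi>_pow by (simp add: minus_eq)
        then have "c dvd \<rho> f ^ n" using c by simp
        then show ?thesis using \<rho>f by auto
      qed
      have "d dvd c" using c[of c] d[of c] FP by auto
      then obtain c' where c': "c = d * c'" by (auto simp: dvd_def)
      have "d dvd \<rho> g" using prime_mem_iff[OF Pp gc] gP d by simp
      then obtain q where q: "\<rho> g = d * q" by (auto simp: dvd_def)
      let ?D = "PIdl (\<phi> d)"
      have D: "ideal ?D R" by (simp add: cgenideal_ideal)
      \<comment> \<open>Modulo \<open>\<phi> d\<close>, \<open>g\<close> agrees with the nilpotent
        \<open>g - \<phi> (\<rho> g)\<close>; this puts a power of \<open>g\<close> into
        \<open>?D\<close>.\<close>
      have "g \<ominus> (g \<ominus> \<phi> (\<rho> g)) = \<phi> q \<otimes> \<phi> d"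
      proof -
        have "g \<ominus> (g \<ominus> x) = x" if "x \<in> carrier R" for x using gc that by algebra
        then show ?thesis by (simp add: q \<phi>_mult m_comm)
      qed
      then have gD: "g \<ominus> (g \<ominus> \<phi> (\<rho> g)) \<in> ?D" by (auto simp: cgenideal_def)
      obtain n :: nat where n: "(g \<ominus> \<phi> (\<rho> g)) [^] n = \<zero>"
        using nilpotent[of "g \<ominus> \<phi> (\<rho> g)"] diff_in_K[OF gc] by auto
      have "g [^] n \<ominus> (g \<ominus> \<phi> (\<rho> g)) [^] n \<in> ?D"
        using ideal_pow_diff[OF D gc _ gD] gc by simp
      then have "g [^] n \<in> ?D" using gc unfolding n by (simp add: minus_eq)
      then obtain x where x: "x \<in> carrier R" "g [^] n = x \<otimes> \<phi> d" by (auto simp: cgenideal_def)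
      have "\<phi> c' \<otimes> g [^] n = x \<otimes> \<phi> c"
      proof -
        have "y \<otimes> (x \<otimes> z) = x \<otimes> (z \<otimes> y)" if "y \<in> carrier R" "z \<in> carrier R" for y z
          using x(1) that by algebra
        then show ?thesis by (simp add: x(2) c' \<phi>_mult)
      qed
      then have "\<phi> c' \<otimes> g [^] n \<in> ?F" using F.I_l_closed[OF _ x(1)] c by simp
      then have "\<phi> c' \<in> ?F" using gpow by simp
      then obtain k where "c' = c * k" using c[of c'] by (auto simp: dvd_def)
      then have "c * 1 = c * (d * k)" using c' by (metis mult.left_commute mult.right_neutral)
      then have "1 = d * k" using \<open>c \<noteq> 0\<close> mult_left_cancel[of c 1 "d * k"] by blast
      then have "d dvd 1" by (rule dvdI)
      then show False using prime_generator_not_unit[OF Pp d] by simp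
    qed
  qed
qed

lemma cohen_macaulayI:
  assumes "noetherian_ring R"
    and "\<And>p f. p \<noteq> 0 \<Longrightarrow> f \<in> carrier R \<Longrightarrow> f \<otimes> \<phi> p = \<zero> \<Longrightarrow> f = \<zero>"
  shows "cohen_macaulay R"
  using assms depth_maximal prime_height_maximal is_cring
  unfolding cohen_macaulay_def by metis

end

section \<open>The graded ring of a numerical semigroup ring, in monomial form\<close>

text \<open>The case in which the initial forms of \<open>t^i\<close> and \<open>t^j\<close> have a
  nonzero product.\<close>

definition ord_additive :: "nat set \<Rightarrow> nat \<Rightarrow> nat \<Rightarrow> bool" where
  "ord_additive S i j \<longleftrightarrow> i \<in> S \<and> j \<in> S \<and> sg_ord S (i + j) = sg_ord S i + sg_ord S j"

text \<open>A convolution with weights 0 and 1. The list stops at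
  \<open>degree f + degree g\<close>, beyond which all terms vanish.\<close>

definition gr_mult :: "nat set \<Rightarrow> 'k::field poly \<Rightarrow> 'k poly \<Rightarrow> 'k poly" where
  "gr_mult S f g = Poly (map (\<lambda>n. \<Sum>i=0..n. of_bool (ord_additive S i (n - i)) * coeff f i * coeff g (n - i))
     [0..<Suc (degree f + degree g)])"

text \<open>The graded ring on its monomial basis. The coefficient at \<open>n\<close> belongs to
  degree \<open>sg_ord S n\<close>, not to degree \<open>n\<close>.\<close>

definition gr_ring :: "nat set \<Rightarrow> 'k::field poly ring" where
  "gr_ring S = \<lparr>carrier = {f. \<forall>n. coeff f n \<noteq> 0 \<longrightarrow> n \<in> S},
     mult = gr_mult S, one = 1, zero = 0, add = (+)\<rparr>"

text \<open>The substitution of \<open>t^m\<close> for the variable; \<open>unstretch\<close> reads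
  off the exponents divisible by \<open>m\<close>.\<close>

definition stretch :: "nat \<Rightarrow> 'k::field poly \<Rightarrow> 'k poly" where
  "stretch m p = Poly (map (\<lambda>n. if m dvd n then coeff p (n div m) else 0) [0..<Suc (m * degree p)])"

definition unstretch :: "nat \<Rightarrow> 'k::field poly \<Rightarrow> 'k poly" where
  "unstretch m p = Poly (map (\<lambda>n. coeff p (m * n)) [0..<Suc (degree p)])"

lemma coeff_Poly_upt: "coeff (Poly (map c [0..<N])) n = (if n < N then c n else 0)"
  by (auto simp: coeff_Poly_eq nth_default_def)

lemma coeff_gr_mult:
  "coeff (gr_mult S f g) n =
    (\<Sum>i=0..n. of_bool (ord_additive S i (n - i)) * coeff f i * coeff g (n - i))"
proof -
  have "(\<Sum>i=0..n. of_bool (ord_additive S i (n - i)) * coeff f i * coeff g (n - i)) = 0"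
    if "n > degree f + degree g"
  proof (rule sum.neutral, rule ballI)
    fix i assume "i \<in> {0..n}"
    then have "i > degree f \<or> n - i > degree g" using that by auto
    then show "of_bool (ord_additive S i (n - i)) * coeff f i * coeff g (n - i) = 0"
      by (auto simp: coeff_eq_0)
  qed
  then show ?thesis unfolding gr_mult_def coeff_Poly_upt by auto
qed

lemma coeff_stretch:
  assumes "m > 0"
  shows "coeff (stretch m p) n = (if m dvd n then coeff p (n div m) else 0)"
proof -
  have "coeff p (n div m) = 0" if "m dvd n" "\<not> n < Suc (m * degree p)"
  proof (rule coeff_eq_0)
    have "m * degree p < m * (n div m)" using that by simp
    then show "degree p < n div m" by simp
  qed
  then show ?thesis unfolding stretch_def coeff_Poly_upt by auto
qed

lemma coeff_unstretch:
  assumes "m > 0"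
  shows "coeff (unstretch m p) n = coeff p (m * n)"
proof -
  have "coeff p (m * n) = 0" if "\<not> n < Suc (degree p)"
  proof (rule coeff_eq_0)
    have "1 * n \<le> m * n" using assms by (intro mult_le_mono1) simp
    then show "degree p < m * n" using that by linarith
  qed
  then show ?thesis unfolding unstretch_def coeff_Poly_upt by auto
qed

lemma sum_over_multiples:
  fixes F :: "nat \<Rightarrow> 'b::comm_monoid_add"
  assumes "m > 0" "\<And>i. i \<le> m * k \<Longrightarrow> \<not> m dvd i \<Longrightarrow> F i = 0"
  shows "(\<Sum>i=0..m * k. F i) = (\<Sum>i\<le>k. F (m * i))"
proof -
  have "(\<Sum>i=0..m * k. F i) = (\<Sum>i\<in>(\<lambda>i. m * i) ` {..k}. F i)"
  proof (rule sum.mono_neutral_right)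
    show "(\<lambda>i. m * i) ` {..k} \<subseteq> {0..m * k}" by auto
    show "\<forall>i\<in>{0..m * k} - (\<lambda>i. m * i) ` {..k}. F i = 0"
    proof
      fix i assume i: "i \<in> {0..m * k} - (\<lambda>i. m * i) ` {..k}"
      have "\<not> m dvd i"
      proof
        assume "m dvd i"
        then obtain j where j: "i = m * j" by (auto simp: dvd_def)
        then have "j \<le> k" using i assms(1) by simp
        then show False using i j by blast
      qed
      then show "F i = 0" using assms(2) i by simp
    qed
  qed simp
  also have "\<dots> = (\<Sum>i\<le>k. F (m * i))"
    using assms(1) by (subst sum.reindex) (auto simp: inj_on_def)
  finally show ?thesis .
qed

lemma gr_ring_simps [simp]:
  "f \<in> carrier (gr_ring S) \<longleftrightarrow> (\<forall>n. coeff f n \<noteq> 0 \<longrightarrow> n \<in> S)"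
  "mult (gr_ring S) = gr_mult S" "one (gr_ring S) = 1" "zero (gr_ring S) = 0"
  "add (gr_ring S) = (+)"
  by (auto simp: gr_ring_def)

context numerical_sg
begin

text \<open>By superadditivity of the order, each side says that the order of
  \<open>i + j + l\<close> is the sum of the three orders.\<close>

lemma ord_additive_assoc:
  "ord_additive S i j \<and> ord_additive S (i + j) l \<longleftrightarrow> ord_additive S j l \<and> ord_additive S i (j + l)"
proof (cases "i \<in> S \<and> j \<in> S \<and> l \<in> S")
  case True
  then show ?thesis
    using sg_ord_add[of i j] sg_ord_add[of j l] sg_ord_add[of i "j + l"] sg_ord_add[of "i + j" l]
      add_in[of i j] add_in[of j l]
    by (auto simp: ord_additive_def add.assoc)
qed (auto simp: ord_additive_def)

lemma gr_mult_assoc: "gr_mult S (gr_mult S f g) h = gr_mult S f (gr_mult S g h)"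
proof (rule poly_eqI)
  fix n
  define F where "F i j l = of_bool (ord_additive S i j \<and> ord_additive S (i + j) l) *
    coeff f i * coeff g j * coeff h l" for i j l
  have "coeff (gr_mult S (gr_mult S f g) h) n = (\<Sum>j=0..n. \<Sum>i=0..j. F i (j - i) (n - j))"
    by (simp add: coeff_gr_mult F_def sum_distrib_left sum_distrib_right of_bool_conj mult_ac)
  also have "\<dots> = (\<Sum>j=0..n. \<Sum>i=0..n - j. F j i (n - j - i))"
    by (rule fps_mult_assoc_lemma)
  also have "\<dots> = coeff (gr_mult S f (gr_mult S g h)) n"
    by (simp add: coeff_gr_mult F_def ord_additive_assoc sum_distrib_left sum_distrib_right
        of_bool_conj mult_ac)
  finally show "coeff (gr_mult S (gr_mult S f g) h) n = coeff (gr_mult S f (gr_mult S g h)) n" .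
qed

lemma gr_mult_commute: "gr_mult S f g = gr_mult S g f"
proof (rule poly_eqI)
  fix n
  have "coeff (gr_mult S f g) n =
    (\<Sum>i=0..n. of_bool (ord_additive S (n - i) (n - (n - i))) * coeff f (n - i) * coeff g (n - (n - i)))"
    unfolding coeff_gr_mult by (rule sum.reindex_bij_witness[of _ "\<lambda>i. n - i" "\<lambda>i. n - i"]) auto
  also have "\<dots> = coeff (gr_mult S g f) n"
    unfolding coeff_gr_mult by (rule sum.cong) (auto simp: ord_additive_def add.commute mult_ac)
  finally show "coeff (gr_mult S f g) n = coeff (gr_mult S g f) n" .
qed

lemma gr_mult_add: "gr_mult S f (g + h) = gr_mult S f g + gr_mult S f h"
  by (rule poly_eqI) (simp add: coeff_gr_mult algebra_simps sum.distrib)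

lemma gr_mult_closed:
  assumes "f \<in> carrier (gr_ring S)" "g \<in> carrier (gr_ring S)"
  shows "gr_mult S f g \<in> carrier (gr_ring S)"
proof -
  have "n \<in> S" if nz: "coeff (gr_mult S f g) n \<noteq> 0" for n
  proof -
    obtain i where "i \<in> {0..n}" "of_bool (ord_additive S i (n - i)) * coeff f i * coeff g (n - i) \<noteq> 0"
      using nz unfolding coeff_gr_mult by (elim sum.not_neutral_contains_not_neutral)
    then have "i \<le> n" "i \<in> S" "n - i \<in> S" by (auto simp: ord_additive_def split: if_splits)
    then show ?thesis using add_in[of i "n - i"] by simp
  qed
  then show ?thesis by simp
qed

lemma ord_additive_0: "s \<in> S \<Longrightarrow> ord_additive S 0 s"
  using zero_in by (simp add: ord_additive_def)

lemma gr_mult_one: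
  assumes "f \<in> carrier (gr_ring S)"
  shows "gr_mult S 1 f = f"
proof (rule poly_eqI)
  fix n
  have "coeff (gr_mult S 1 f) n = (\<Sum>i\<in>{0}. of_bool (ord_additive S i (n - i)) * coeff 1 i * coeff f (n - i))"
    unfolding coeff_gr_mult by (rule sum.mono_neutral_right) (auto simp: coeff_1)
  also have "\<dots> = coeff f n"
    using assms ord_additive_0[of n] by (auto simp: coeff_1)
  finally show "coeff (gr_mult S 1 f) n = coeff f n" .
qed

lemma gr_ring_cring: "cring (gr_ring S :: 'k::field poly ring)"
proof (rule cringI)
  show "abelian_group (gr_ring S :: 'k poly ring)"
  proof (rule abelian_groupI)
    fix x :: "'k poly" assume "x \<in> carrier (gr_ring S)"
    then show "\<exists>y\<in>carrier (gr_ring S). y \<oplus>\<^bsub>gr_ring S\<^esub> x = \<zero>\<^bsub>gr_ring S\<^esub>"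
      by (intro bexI[of _ "- x"]) auto
  next
    fix x y :: "'k poly" assume "x \<in> carrier (gr_ring S)" "y \<in> carrier (gr_ring S)"
    then have "n \<in> S" if "coeff x n + coeff y n \<noteq> 0" for n
      using that by (cases "coeff x n = 0") auto
    then show "x \<oplus>\<^bsub>gr_ring S\<^esub> y \<in> carrier (gr_ring S)" by simp
  qed auto
  show "comm_monoid (gr_ring S :: 'k poly ring)"
  proof (rule comm_monoidI)
    show "\<one>\<^bsub>gr_ring S\<^esub> \<in> carrier (gr_ring S)"
      using zero_in by (auto simp: coeff_1 split: if_splits)
  next
    fix x y :: "'k poly" assume "x \<in> carrier (gr_ring S)" "y \<in> carrier (gr_ring S)"
    then show "x \<otimes>\<^bsub>gr_ring S\<^esub> y \<in> carrier (gr_ring S)"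
      using gr_mult_closed by (simp only: gr_ring_simps(2))
  next
    fix x :: "'k poly" assume "x \<in> carrier (gr_ring S)"
    then show "\<one>\<^bsub>gr_ring S\<^esub> \<otimes>\<^bsub>gr_ring S\<^esub> x = x"
      using gr_mult_one by (simp only: gr_ring_simps(2,3))
  next
    fix x y z :: "'k poly"
    show "x \<otimes>\<^bsub>gr_ring S\<^esub> y \<otimes>\<^bsub>gr_ring S\<^esub> z = x \<otimes>\<^bsub>gr_ring S\<^esub> (y \<otimes>\<^bsub>gr_ring S\<^esub> z)"
      by (simp add: gr_mult_assoc)
    show "x \<otimes>\<^bsub>gr_ring S\<^esub> y = y \<otimes>\<^bsub>gr_ring S\<^esub> x"
      by (simp add: gr_mult_commute)
  qed
next
  fix x y z :: "'k poly"
  show "(x \<oplus>\<^bsub>gr_ring S\<^esub> y) \<otimes>\<^bsub>gr_ring S\<^esub> z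
    = x \<otimes>\<^bsub>gr_ring S\<^esub> z \<oplus>\<^bsub>gr_ring S\<^esub> y \<otimes>\<^bsub>gr_ring S\<^esub> z"
    by (simp add: gr_mult_commute[of _ z] gr_mult_add)
qed

section \<open>The defect, and the retraction onto a polynomial ring\<close>

definition defect :: "nat \<Rightarrow> nat" where "defect s = s - m * sg_ord S s"

text \<open>By \<open>sg_ord_ge\<close> the natural subtraction in \<open>defect\<close> does not
  truncate on \<open>S\<close>.\<close>

lemma defect_eq: "s \<in> S \<Longrightarrow> s = m * sg_ord S s + defect s"
  using sg_ord_ge[of s] by (simp add: defect_def mult.commute)

lemma defect_add:
  assumes "ord_additive S i j"
  shows "defect (i + j) = defect i + defect j"
proof -
  have "i \<in> S" "j \<in> S" "i + j \<in> S" "sg_ord S (i + j) = sg_ord S i + sg_ord S j"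
    using assms add_in by (auto simp: ord_additive_def)
  then show ?thesis using defect_eq[of i] defect_eq[of j] defect_eq[of "i + j"]
    by (simp add: add_mult_distrib2)
qed

lemma defect_mult_m: "defect (m * k) = 0"
  using sg_ord_mult_m[of k] by (simp add: defect_def mult.commute)

lemma dvd_if_defect_0: "s \<in> S \<Longrightarrow> defect s = 0 \<Longrightarrow> m dvd s"
  using defect_eq[of s] by (metis add.right_neutral dvd_triv_left)

text \<open>Beyond the conductor write \<open>s = u + k * m\<close> with \<open>u\<close> in a
  window of length \<open>m\<close>. The order of \<open>s\<close> is at least \<open>k\<close>, so
  its defect is at most \<open>u\<close>.\<close>

lemma defect_bounded: obtains B where "\<And>s. s \<in> S \<Longrightarrow> defect s \<le> B"
proof -
  obtain c where c: "\<And>n. n \<ge> c \<Longrightarrow> n \<in> S" using ex_conductor by blast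
  have "defect s \<le> c + m" if "s \<in> S" for s
  proof (cases "s < c")
    case True
    then show ?thesis by (simp add: defect_def)
  next
    case False
    define k where "k = (s - c) div m"
    define u where "u = c + (s - c) mod m"
    have s: "s = u + k * m"
      using False div_mult_mod_eq[of "s - c" m] unfolding k_def u_def by linarith
    have "u \<in> S" using c by (simp add: u_def)
    then have "k \<le> sg_ord S s"
      using sg_ord_add[of u "k * m"] sg_ord_mult_m[of k] add_mult_m_in[OF zero_in, of k] s by simp
    then have "m * k \<le> m * sg_ord S s" by (rule mult_le_mono2)
    then have "defect s \<le> u" using s mult.commute[of m k] unfolding defect_def by linarith
    also have "u \<le> c + m" using m_pos by (simp add: u_def less_imp_le)
    finally show ?thesis .
  qed
  then show thesis by (rule that)
qed

lemma gr_mult_defect: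
  assumes "\<And>n. coeff f n \<noteq> 0 \<Longrightarrow> a \<le> defect n" "\<And>n. coeff g n \<noteq> 0 \<Longrightarrow> b \<le> defect n"
    and "coeff (gr_mult S f g) n \<noteq> 0"
  shows "a + b \<le> defect n"
proof -
  obtain i where "i \<in> {0..n}" "of_bool (ord_additive S i (n - i)) * coeff f i * coeff g (n - i) \<noteq> 0"
    using assms(3) unfolding coeff_gr_mult by (elim sum.not_neutral_contains_not_neutral)
  then have "i \<le> n" "ord_additive S i (n - i)" "coeff f i \<noteq> 0" "coeff g (n - i) \<noteq> 0"
    by (auto split: if_splits)
  then show ?thesis using assms(1)[of i] assms(2)[of "n - i"] defect_add[of i "n - i"] by simp
qed

text \<open>An additive pair with sum \<open>m * k\<close> has total defect 0, and an element of
  \<open>S\<close> of defect 0 is a multiple of \<open>m\<close>.\<close>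

lemma not_m_dvd_weight:
  assumes "i \<le> m * k" "\<not> m dvd i"
  shows "\<not> ord_additive S i (m * k - i)"
proof
  assume w: "ord_additive S i (m * k - i)"
  have "defect i = 0" using defect_add[OF w] assms(1) defect_mult_m[of k] by simp
  then show False using dvd_if_defect_0 w assms(2) by (auto simp: ord_additive_def)
qed

lemma ord_additive_mult_m: "ord_additive S (m * i) (m * j)"
  using add_mult_m_in[OF zero_in] sg_ord_mult_m
  by (simp add: ord_additive_def mult.commute[of m] add_mult_distrib[symmetric])

text \<open>At multiples of \<open>m\<close> only pairs of multiples contribute, all with weight 1,
  so the product is the ordinary one of polynomials in \<open>t^m\<close>. This makes both
  \<open>stretch\<close> and \<open>unstretch\<close> multiplicative.\<close>

lemma coeff_gr_mult_mult_m:
  "coeff (gr_mult S f g) (m * k) = (\<Sum>i\<le>k. coeff f (m * i) * coeff g (m * (k - i)))"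
proof -
  have "coeff (gr_mult S f g) (m * k) =
    (\<Sum>i\<le>k. of_bool (ord_additive S (m * i) (m * k - m * i)) * coeff f (m * i) * coeff g (m * k - m * i))"
    unfolding coeff_gr_mult
    by (rule sum_over_multiples[OF m_pos]) (simp add: not_m_dvd_weight)
  also have "\<dots> = (\<Sum>i\<le>k. coeff f (m * i) * coeff g (m * (k - i)))"
    using ord_additive_mult_m by (intro sum.cong) (simp_all add: diff_mult_distrib2[symmetric])
  finally show ?thesis .
qed

text \<open>The kernel of \<open>unstretch\<close> is supported in positive defect. Its
  \<open>k\<close>-th powers have defect at least \<open>k\<close>, while the defect is bounded on
  \<open>S\<close>; hence the kernel is nil.\<close>

lemma gr_ring_poly_retract:
  "poly_retract (gr_ring S :: 'k::field poly ring) (stretch m) (unstretch m)"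
proof -
  interpret R: cring "gr_ring S :: 'k poly ring" by (rule gr_ring_cring)
  show ?thesis
  proof unfold_locales
    fix p q :: "'k poly"
    show "stretch m p \<in> carrier (gr_ring S)"
      using m_pos add_mult_m_in[OF zero_in]
      by (auto simp: coeff_stretch mult.commute split: if_splits elim!: dvdE)
    show "stretch m (p + q) = stretch m p \<oplus>\<^bsub>gr_ring S\<^esub> stretch m q"
      by (simp, rule poly_eqI) (simp add: coeff_stretch m_pos)
    show "stretch m (p * q) = stretch m p \<otimes>\<^bsub>gr_ring S\<^esub> stretch m q"
    proof (simp, rule poly_eqI)
      fix n
      show "coeff (stretch m (p * q)) n = coeff (gr_mult S (stretch m p) (stretch m q)) n"
      proof (cases "m dvd n")
        case True
        then obtain k where k: "n = m * k" by (auto simp: dvd_def)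
        show ?thesis unfolding k coeff_gr_mult_mult_m
          using m_pos by (simp add: coeff_stretch coeff_mult)
      next
        case False
        have "(\<Sum>i=0..n. of_bool (ord_additive S i (n - i)) * coeff (stretch m p) i * coeff (stretch m q) (n - i)) = 0"
        proof (rule sum.neutral, rule ballI)
          fix i assume "i \<in> {0..n}"
          then have "\<not> (m dvd i \<and> m dvd n - i)"
            using False dvd_add[of m i "n - i"] by auto
          then show "of_bool (ord_additive S i (n - i)) * coeff (stretch m p) i * coeff (stretch m q) (n - i) = 0"
            using m_pos by (auto simp: coeff_stretch)
        qed
        then show ?thesis using False m_pos by (simp add: coeff_stretch coeff_gr_mult)
      qed
    qed
    show "stretch m 1 = \<one>\<^bsub>gr_ring S\<^esub>"
      using m_pos by (simp, intro poly_eqI) (auto simp: coeff_stretch coeff_1 elim!: dvdE)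
    show "unstretch m (stretch m p) = p"
      using m_pos by (intro poly_eqI) (simp add: coeff_stretch coeff_unstretch)
  next
    fix f g :: "'k poly"
    show "unstretch m (f \<oplus>\<^bsub>gr_ring S\<^esub> g) = unstretch m f + unstretch m g"
      by (rule poly_eqI) (simp add: coeff_unstretch m_pos)
    show "unstretch m (f \<otimes>\<^bsub>gr_ring S\<^esub> g) = unstretch m f * unstretch m g"
      by (rule poly_eqI) (simp add: coeff_unstretch m_pos coeff_gr_mult_mult_m coeff_mult)
  next
    fix f :: "'k poly" assume f: "f \<in> carrier (gr_ring S)" and "unstretch m f = 0"
    then have z: "coeff f (m * k) = 0" for k
      using coeff_unstretch[OF m_pos, of f k] by simp
    have d1: "1 \<le> defect n" if "coeff f n \<noteq> 0" for n
    proof -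
      have "n \<in> S" using f that unfolding gr_ring_simps by blast
      moreover have "\<not> m dvd n" using z that by (auto elim!: dvdE)
      ultimately have "defect n \<noteq> 0" using dvd_if_defect_0 by blast
      then show ?thesis by simp
    qed
    have pow: "coeff (f [^]\<^bsub>gr_ring S\<^esub> k) n \<noteq> 0 \<Longrightarrow> k \<le> defect n" for k :: nat and n
    proof (induction k arbitrary: n)
      case (Suc k)
      then have "coeff (gr_mult S (f [^]\<^bsub>gr_ring S\<^esub> k) f) n \<noteq> 0" by simp
      from gr_mult_defect[OF Suc.IH d1 this] show ?case by simp
    qed simp
    obtain B where B: "\<And>s. s \<in> S \<Longrightarrow> defect s \<le> B" using defect_bounded by blast
    have "f [^]\<^bsub>gr_ring S\<^esub> Suc B = 0"
    proof (rule poly_eqI, rule ccontr)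
      fix n assume "coeff (f [^]\<^bsub>gr_ring S\<^esub> Suc B) n \<noteq> coeff 0 n"
      then have nz: "coeff (f [^]\<^bsub>gr_ring S\<^esub> Suc B) n \<noteq> 0" by simp
      have "f [^]\<^bsub>gr_ring S\<^esub> Suc B \<in> carrier (gr_ring S)" by (rule R.nat_pow_closed[OF f])
      then have "n \<in> S" using nz unfolding gr_ring_simps by blast
      then show False using B[of n] pow[OF nz] by simp
    qed
    then show "\<exists>n::nat. f [^]\<^bsub>gr_ring S\<^esub> n = \<zero>\<^bsub>gr_ring S\<^esub>"
      by (intro exI[of _ "Suc B"]) (simp only: gr_ring_simps)
  qed
qed

section \<open>Regularity of \<open>t^m\<close> and finite generation of ideals\<close>

lemma regular_add_mult_m:
  assumes reg: "\<forall>s\<in>S. sg_ord S (s + m) = sg_ord S s + 1" and "s \<in> S"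
  shows "ord_additive S s (m * k)"
proof -
  have "sg_ord S (s + k * m) = sg_ord S s + k"
  proof (induction k)
    case (Suc k)
    then show ?case using reg add_mult_m_in[OF \<open>s \<in> S\<close>, of k]
      by (auto simp: algebra_simps)
  qed simp
  then show ?thesis
    using \<open>s \<in> S\<close> add_mult_m_in[OF zero_in, of k] sg_ord_mult_m[of k]
    by (simp add: ord_additive_def mult.commute)
qed

text \<open>Degrees here are those of polynomials in \<open>t\<close>. Only the two leading terms
  meet in the top exponent, and regularity gives them weight 1.\<close>

lemma coeff_gr_mult_stretch_top:
  fixes f p :: "'k::field poly"
  assumes reg: "\<forall>s\<in>S. sg_ord S (s + m) = sg_ord S s + 1"
    and f: "f \<in> carrier (gr_ring S)" "f \<noteq> 0"
  shows "coeff (gr_mult S f (stretch m p)) (degree f + m * degree p) = lead_coeff f * lead_coeff p"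
    and "degree (gr_mult S f (stretch m p)) \<le> degree f + m * degree p"
proof -
  let ?N = "degree f + m * degree p"
  have deg: "degree f \<in> S" using f by simp
  have high: "coeff (stretch m p) n = 0" if "n > m * degree p" for n
  proof (cases "m dvd n")
    case True
    then obtain k where k: "n = m * k" by (auto simp: dvd_def)
    then have "k > degree p" using that by simp
    then show ?thesis using k m_pos by (simp add: coeff_stretch coeff_eq_0)
  qed (simp add: coeff_stretch m_pos)
  have "coeff (gr_mult S f (stretch m p)) ?N =
    (\<Sum>i\<in>{degree f}. of_bool (ord_additive S i (?N - i)) * coeff f i * coeff (stretch m p) (?N - i))"
    unfolding coeff_gr_mult
  proof (rule sum.mono_neutral_right)
    show "\<forall>i\<in>{0..?N} - {degree f}.
      of_bool (ord_additive S i (?N - i)) * coeff f i * coeff (stretch m p) (?N - i) = 0"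
    proof
      fix i assume i: "i \<in> {0..?N} - {degree f}"
      then consider "i > degree f" | "i < degree f" by fastforce
      then show "of_bool (ord_additive S i (?N - i)) * coeff f i * coeff (stretch m p) (?N - i) = 0"
        by cases (auto simp: coeff_eq_0 high)
    qed
  qed auto
  also have "\<dots> = lead_coeff f * lead_coeff p"
    using regular_add_mult_m[OF reg deg] m_pos by (simp add: coeff_stretch)
  finally show "coeff (gr_mult S f (stretch m p)) ?N = lead_coeff f * lead_coeff p" .
  show "degree (gr_mult S f (stretch m p)) \<le> ?N"
  proof (rule degree_le, intro allI impI)
    fix n assume n: "?N < n"
    show "coeff (gr_mult S f (stretch m p)) n = 0"
      unfolding coeff_gr_mult
    proof (rule sum.neutral, rule ballI)
      fix i assume "i \<in> {0..n}"
      then have "i > degree f \<or> n - i > m * degree p" using n by auto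
      then show "of_bool (ord_additive S i (n - i)) * coeff f i * coeff (stretch m p) (n - i) = 0"
        using high by (auto simp: coeff_eq_0)
    qed
  qed
qed

lemma gr_ring_stretch_regular:
  fixes f p :: "'k::field poly"
  assumes reg: "\<forall>s\<in>S. sg_ord S (s + m) = sg_ord S s + 1"
    and f: "f \<in> carrier (gr_ring S)" and "p \<noteq> 0" "f \<otimes>\<^bsub>gr_ring S\<^esub> stretch m p = \<zero>\<^bsub>gr_ring S\<^esub>"
  shows "f = \<zero>\<^bsub>gr_ring S\<^esub>"
  using coeff_gr_mult_stretch_top(1)[OF reg f, of p] assms(3,4)
  by (cases "f = 0") (simp_all del: gr_ring_simps(1))

text \<open>\<open>stretch m [:0, 1:]\<close> is \<open>t^m\<close>; the only candidate term sits at
  \<open>s + m\<close>, where the weight is 0.\<close>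

lemma gr_ring_not_regular:
  assumes "s \<in> S" "sg_ord S (s + m) \<noteq> sg_ord S s + 1"
  shows "monom 1 s \<otimes>\<^bsub>gr_ring S\<^esub> stretch m [:0, 1:] = (\<zero>\<^bsub>gr_ring S\<^esub> :: 'k::field poly)"
proof (simp, rule poly_eqI)
  fix n
  have "\<not> ord_additive S s m"
    using assms sg_ord_mult_m[of 1] by (simp add: ord_additive_def)
  have "(\<Sum>i=0..n. of_bool (ord_additive S i (n - i)) * coeff (monom (1::'k) s) i *
      coeff (stretch m [:0, 1:]) (n - i)) = 0"
  proof (rule sum.neutral, rule ballI, rule ccontr)
    fix i
    assume "of_bool (ord_additive S i (n - i)) * coeff (monom (1::'k) s) i * coeff (stretch m [:0, 1:]) (n - i) \<noteq> 0"
    then have *: "ord_additive S i (n - i)" "i = s" "m dvd n - i" "coeff [:0, 1::'k:] ((n - i) div m) \<noteq> 0"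
      using m_pos by (auto simp: coeff_stretch split: if_splits)
    have "(n - i) div m = 1"
      using *(4) by (auto simp: coeff_pCons split: nat.splits)
    then have "n - i = m" using *(3) by (metis dvd_div_mult_self mult_1)
    then show False using * \<open>\<not> ord_additive S s m\<close> by simp
  qed
  then show "coeff (gr_mult S (monom 1 s) (stretch m [:0, 1:])) n = coeff (0 :: 'k poly) n"
    by (simp add: coeff_gr_mult)
qed

text \<open>Division algorithm over \<open>k[t^m]\<close>: for each residue class modulo
  \<open>m\<close>, take an element of \<open>I\<close> of least degree in that class. Multiplying
  it by a monomial in \<open>t^m\<close> matches the leading term of any member of \<open>I\<close>
  in the same class.\<close>

lemma gr_ring_noetherian:
  assumes reg: "\<forall>s\<in>S. sg_ord S (s + m) = sg_ord S s + 1"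
  shows "noetherian_ring (gr_ring S :: 'k::field poly ring)"
proof -
  interpret R: poly_retract "gr_ring S :: 'k poly ring" "stretch m" "unstretch m"
    by (rule gr_ring_poly_retract)
  show ?thesis
  proof (rule R.noetherian_ringI)
    fix I :: "'k poly set" assume I: "ideal I (gr_ring S)"
    interpret I: ideal I "gr_ring S" by (rule I)
    define P where "P i f \<longleftrightarrow> f \<in> I \<and> f \<noteq> 0 \<and> degree f mod m = i" for i f
    define g where "g i = (ARG_MIN degree f. P i f)" for i
    have g: "P i (g i)" "degree (g i) \<le> degree f" if "P i f" for i f
      using arg_min_nat_lemma[of "P i" f degree] that by (auto simp: g_def)
    define A where "A = g ` {i. i < m \<and> (\<exists>f. P i f)}"
    have AI: "A \<subseteq> I" using g(1) unfolding A_def P_def by blast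
    have Ac: "A \<subseteq> carrier (gr_ring S)" using AI I.a_subset by blast
    interpret J: ideal "Idl\<^bsub>gr_ring S\<^esub> A" "gr_ring S" by (rule R.genideal_ideal[OF Ac])
    have in_J: "f \<in> Idl\<^bsub>gr_ring S\<^esub> A" if "f \<in> I" for f
      using that
    \<comment> \<open>The measure puts 0 below all constants, so a remainder \<open>f' = 0\<close>
      is smaller even when \<open>f\<close> has degree 0.\<close>
    proof (induction "if f = 0 then 0 else Suc (degree f)" arbitrary: f rule: less_induct)
      case less
      show ?case
      proof (cases "f = 0")
        case True
        then show ?thesis using J.zero_closed by simp
      next
        case False
        define i where "i = degree f mod m"
        have Pf: "P i f" using less.prems False by (simp add: P_def i_def)
        let ?g = "g i"
        have Pg: "P i ?g" and deg: "degree ?g \<le> degree f" using g[OF Pf] by auto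
        have "?g \<in> A" unfolding A_def using Pf m_pos by (auto simp: i_def)
        then have gJ: "?g \<in> Idl\<^bsub>gr_ring S\<^esub> A" using R.genideal_self[OF Ac] by blast
        have gI: "?g \<in> I" "?g \<noteq> 0" using Pg by (auto simp: P_def)
        have gc: "?g \<in> carrier (gr_ring S)" using I.Icarr[OF gI(1)] .
        have "m dvd degree f - degree ?g"
          using Pf Pg mod_eq_dvd_iff_nat[OF deg, of m] by (simp add: P_def)
        then obtain k where "degree f - degree ?g = m * k" by (auto simp: dvd_def)
        then have k: "degree f = degree ?g + m * k" using deg by linarith
        define c where "c = lead_coeff f / lead_coeff ?g"
        have c: "c \<noteq> 0" using False gI by (simp add: c_def)
        define h where "h = gr_mult S ?g (stretch m (monom c k))"
        have hI: "h \<in> I" using I.I_r_closed[OF gI(1) R.\<phi>_closed] by (simp add: h_def)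
        have hJ: "h \<in> Idl\<^bsub>gr_ring S\<^esub> A" using J.I_r_closed[OF gJ R.\<phi>_closed] by (simp add: h_def)
        have deg_mon: "degree (monom c k) = k" using c by (simp add: degree_monom_eq)
        have top: "coeff h (degree f) = lead_coeff f"
          using coeff_gr_mult_stretch_top(1)[OF reg gc gI(2), of "monom c k"] gI(2)
          by (simp add: deg_mon h_def[symmetric] k[symmetric]) (simp add: c_def)
        have degh: "degree h \<le> degree f"
          using coeff_gr_mult_stretch_top(2)[OF reg gc gI(2), of "monom c k"]
          by (simp add: deg_mon h_def[symmetric] k[symmetric])
        \<comment> \<open>The ring difference is defined through the inverse in the additive monoid;
          adding \<open>b\<close> back identifies it.\<close>
        have minus: "a \<ominus>\<^bsub>gr_ring S\<^esub> b = a - b" if "a \<in> carrier (gr_ring S)" "b \<in> carrier (gr_ring S)" for a b :: "'k poly"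
        proof -
          have "a \<ominus>\<^bsub>gr_ring S\<^esub> b \<oplus>\<^bsub>gr_ring S\<^esub> b = a"
            by (simp only: R.minus_eq R.a_assoc[OF that(1) R.a_inv_closed[OF that(2)] that(2)]
                R.l_neg[OF that(2)] R.r_zero[OF that(1)])
          then show ?thesis by (simp add: eq_diff_eq)
        qed
        define f' where "f' = f - h"
        have f'I: "f' \<in> I"
          using R.ideal_minus_closed[OF I less.prems hI] minus[OF I.Icarr[OF less.prems] I.Icarr[OF hI]]
          by (simp add: f'_def)
        have "f' = 0 \<or> degree f' < degree f"
        proof (rule disjCI)
          assume "\<not> degree f' < degree f"
          moreover have "degree f' \<le> degree f" unfolding f'_def using degh by (simp add: degree_diff_le)
          ultimately have "degree f' = degree f" by simp
          then have "lead_coeff f' = 0" using top by (simp add: f'_def)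
          then show "f' = 0" by simp
        qed
        then have "f' \<in> Idl\<^bsub>gr_ring S\<^esub> A" using less.hyps[of f'] f'I False by auto
        then have "f' \<oplus>\<^bsub>gr_ring S\<^esub> h \<in> Idl\<^bsub>gr_ring S\<^esub> A" using hJ by (rule J.a_closed)
        then show ?thesis by (simp add: f'_def)
      qed
    qed
    have "I = Idl\<^bsub>gr_ring S\<^esub> A"
      using in_J R.genideal_minimal[OF I AI] by blast
    moreover have "finite A" by (simp add: A_def)
    ultimately show "\<exists>A\<subseteq>carrier (gr_ring S). finite A \<and> I = Idl\<^bsub>gr_ring S\<^esub> A" using Ac by blast
  qed
qed

end

section \<open>Transport along ring isomorphisms\<close>

lemma noetherian_ring_iso:
  assumes R: "noetherian_ring R" and G: "ring G" and h: "h \<in> ring_iso R G"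
  shows "noetherian_ring G"
proof -
  interpret R: noetherian_ring R by (rule R)
  interpret G: ring G by (rule G)
  interpret h: ring_hom_ring R G h
    using ring_hom_ringI2[OF R.ring_axioms G] h by (simp add: ring_iso_def)
  have surj: "h ` carrier R = carrier G" using h by (simp add: ring_iso_def bij_betw_def)
  show ?thesis
  proof (rule G.noetherian_ringI)
    fix I assume I: "ideal I G"
    obtain A where A: "A \<subseteq> carrier R" "finite A" "{r \<in> carrier R. h r \<in> I} = Idl\<^bsub>R\<^esub> A"
      using R.finetely_gen[OF h.ideal_vimage[OF I]] by blast
    have hA: "h ` A \<subseteq> carrier G" using A(1) by auto
    let ?J = "Idl\<^bsub>G\<^esub> (h ` A)"
    have J: "ideal ?J G" using G.genideal_ideal[OF hA] .
    have "h ` A \<subseteq> I" using R.genideal_self[OF A(1)] A(3) by blast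
    then have "?J \<subseteq> I" by (rule G.genideal_minimal[OF I])
    moreover have "I \<subseteq> ?J"
    proof
      fix i assume i: "i \<in> I"
      then obtain r where r: "r \<in> carrier R" "i = h r" using surj ideal.Icarr[OF I i] by blast
      have "A \<subseteq> {r \<in> carrier R. h r \<in> ?J}" using A(1) G.genideal_self[OF hA] by blast
      then have "Idl\<^bsub>R\<^esub> A \<subseteq> {r \<in> carrier R. h r \<in> ?J}"
        by (rule R.genideal_minimal[OF h.ideal_vimage[OF J]])
      then show "i \<in> ?J" using A(3) r i by blast
    qed
    ultimately show "\<exists>A\<subseteq>carrier G. finite A \<and> I = Idl\<^bsub>G\<^esub> A" using hA A(2) by blast
  qed
qed

lemma poly_retract_iso:
  assumes R: "poly_retract R \<phi> \<rho>" and G: "cring G" and h: "h \<in> ring_iso R G"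
  shows "poly_retract G (\<lambda>p. h (\<phi> p)) (\<lambda>g. \<rho> (inv_into (carrier R) h g))"
proof -
  interpret R: poly_retract R \<phi> \<rho> by (rule R)
  interpret G: cring G by (rule G)
  interpret h: ring_hom_ring R G h
    using ring_hom_ringI2[OF R.ring_axioms G.ring_axioms] h by (simp add: ring_iso_def)
  let ?k = "inv_into (carrier R) h"
  have k: "?k \<in> ring_iso G R" by (rule ring_iso_set_sym[OF R.ring_axioms h])
  interpret k: ring_hom_ring G R ?k
    using ring_hom_ringI2[OF G.ring_axioms R.ring_axioms] k by (simp add: ring_iso_def)
  have inj: "inj_on h (carrier R)" and surj: "h ` carrier R = carrier G"
    using h by (auto simp: ring_iso_def bij_betw_def)
  have kh: "?k (h r) = r" if "r \<in> carrier R" for r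
    by (rule inv_into_f_f[OF inj that])
  have hk: "h (?k g) = g" if "g \<in> carrier G" for g
    using that surj by (intro f_inv_into_f) simp
  show ?thesis
  proof unfold_locales
    fix f assume f: "f \<in> carrier G" "\<rho> (?k f) = 0"
    then obtain n :: nat where n: "?k f [^]\<^bsub>R\<^esub> n = \<zero>\<^bsub>R\<^esub>" using R.nilpotent[of "?k f"] by auto
    have "f [^]\<^bsub>G\<^esub> n = h (?k f [^]\<^bsub>R\<^esub> n)"
      using f hk by (simp add: h.hom_nat_pow)
    then show "\<exists>n::nat. f [^]\<^bsub>G\<^esub> n = \<zero>\<^bsub>G\<^esub>" using n by auto
  qed (simp_all add: R.\<phi>_add R.\<phi>_mult R.\<phi>_one R.\<rho>_add R.\<rho>_mult kh)
qed

section \<open>The maximal ideal filtration of a numerical semigroup ring\<close>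

lemma semigroup_ring_simps [simp]:
  "f \<in> carrier (semigroup_ring S) \<longleftrightarrow> (\<forall>n. fps_nth f n \<noteq> 0 \<longrightarrow> n \<in> S)"
  "mult (semigroup_ring S) = (*)" "one (semigroup_ring S) = 1" "zero (semigroup_ring S) = 0"
  "add (semigroup_ring S) = (+)"
  by (auto simp: semigroup_ring_def)

lemma fps_nth_mult_nonzeroE:
  assumes "fps_nth (f * g :: 'k::field fps) n \<noteq> 0"
  obtains i where "i \<le> n" "fps_nth f i \<noteq> 0" "fps_nth g (n - i) \<noteq> 0"
proof -
  obtain i where "i \<in> {0..n}" "fps_nth f i * fps_nth g (n - i) \<noteq> 0"
    using assms unfolding fps_mult_nth by (elim sum.not_neutral_contains_not_neutral)
  then show thesis using that[of i] by auto
qed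

context numerical_sg
begin

abbreviation D :: "'k::field fps ring" where "D \<equiv> semigroup_ring S"

definition ord_ge :: "nat \<Rightarrow> 'k::field fps set" where
  "ord_ge i = {f. \<forall>n. fps_nth f n \<noteq> 0 \<longrightarrow> n \<in> mult_M S i}"

lemma ord_ge_iff: "f \<in> ord_ge i \<longleftrightarrow> (\<forall>n. fps_nth f n \<noteq> 0 \<longrightarrow> n \<in> mult_M S i)"
  by (simp add: ord_ge_def)

lemma ord_ge_0: "ord_ge 0 = carrier (D :: 'k::field fps ring)"
  by (auto simp: ord_ge_iff)

lemma ord_ge_antimono: "i \<le> j \<Longrightarrow> ord_ge j \<subseteq> ord_ge i"
  using mult_M_antimono[of i j] unfolding ord_ge_def by blast

lemma ord_ge_carrier: "f \<in> ord_ge i \<Longrightarrow> f \<in> carrier D"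
  using ord_ge_antimono[of 0 i] ord_ge_0 by blast

lemma ord_ge_mult: "f \<in> ord_ge i \<Longrightarrow> g \<in> ord_ge j \<Longrightarrow> f * g \<in> ord_ge (i + j)"
  unfolding ord_ge_iff
proof (intro allI impI)
  fix n
  assume f: "\<forall>n. fps_nth f n \<noteq> 0 \<longrightarrow> n \<in> mult_M S i" and g: "\<forall>n. fps_nth g n \<noteq> 0 \<longrightarrow> n \<in> mult_M S j"
    and "fps_nth (f * g) n \<noteq> 0"
  then obtain k where "k \<le> n" "k \<in> mult_M S i" "n - k \<in> mult_M S j"
    by (elim fps_nth_mult_nonzeroE) auto
  then show "n \<in> mult_M S (i + j)" using mult_M_add[of k i "n - k" j] by simp
qed

lemma ord_ge_add: "f \<in> ord_ge i \<Longrightarrow> g \<in> ord_ge i \<Longrightarrow> f + g \<in> ord_ge i"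
  unfolding ord_ge_iff by (metis add_0 fps_add_nth)

lemma ord_ge_uminus: "f \<in> ord_ge i \<Longrightarrow> - f \<in> ord_ge i"
  unfolding ord_ge_iff by simp

lemma D_cring: "cring (D :: 'k::field fps ring)"
proof (rule cringI)
  have closed: "f * g \<in> ord_ge 0" "f + g \<in> ord_ge 0" "- f \<in> ord_ge 0"
    if "f \<in> ord_ge 0" "g \<in> ord_ge 0" for f g :: "'k fps"
    using that ord_ge_mult[of f 0 g 0] ord_ge_add ord_ge_uminus by auto
  have one: "1 \<in> ord_ge 0" using zero_in by (simp add: ord_ge_iff fps_one_nth)
  show "abelian_group (D :: 'k fps ring)"
  proof (rule abelian_groupI, unfold ord_ge_0[symmetric])
    fix x :: "'k fps" assume "x \<in> ord_ge 0"
    then show "\<exists>y\<in>ord_ge 0. y \<oplus>\<^bsub>D\<^esub> x = \<zero>\<^bsub>D\<^esub>"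
      using closed by (intro bexI[of _ "- x"]) auto
  qed (use closed in \<open>auto simp: ord_ge_iff[of 0]\<close>)
  show "comm_monoid (D :: 'k fps ring)"
    by (rule comm_monoidI, unfold ord_ge_0[symmetric]) (use closed one in \<open>auto simp: mult_ac\<close>)
qed (simp add: algebra_simps)

lemma D_minus:
  fixes f g :: "'k::field fps"
  assumes "f \<in> carrier D" "g \<in> carrier D"
  shows "f \<ominus>\<^bsub>D\<^esub> g = f - g"
proof -
  interpret D: cring "D :: 'k fps ring" by (rule D_cring)
  have "f \<ominus>\<^bsub>D\<^esub> g \<oplus>\<^bsub>D\<^esub> g = f"
    by (simp only: D.minus_eq D.a_assoc[OF assms(1) D.a_inv_closed[OF assms(2)] assms(2)]
        D.l_neg[OF assms(2)] D.r_zero[OF assms(1)])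
  then show ?thesis by (simp add: eq_diff_eq)
qed

lemma ord_ge_ideal: "ideal (ord_ge i) (D :: 'k::field fps ring)"
proof (rule idealI)
  interpret D: cring "D :: 'k fps ring" by (rule D_cring)
  show "ring (D :: 'k fps ring)" by (rule D.ring_axioms)
  have zero: "0 \<in> ord_ge i" by (simp add: ord_ge_iff)
  show "subgroup (ord_ge i) (add_monoid (D :: 'k fps ring))"
  proof
    fix x :: "'k fps" assume x: "x \<in> ord_ge i"
    have "\<zero>\<^bsub>D\<^esub> \<ominus>\<^bsub>D\<^esub> x = 0 - x" using D_minus[of 0 x] ord_ge_carrier[OF x] by simp
    then have "\<ominus>\<^bsub>D\<^esub> x = - x"
      using ord_ge_carrier[OF x] by (simp only: D.minus_eq D.l_zero[OF D.a_inv_closed]) simp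
    then show "inv\<^bsub>add_monoid D\<^esub> x \<in> ord_ge i" using ord_ge_uminus[OF x] by (simp add: a_inv_def)
  qed (use ord_ge_carrier ord_ge_add zero in \<open>auto simp del: semigroup_ring_simps(1)\<close>)
next
  fix a x :: "'k fps" assume "a \<in> ord_ge i" "x \<in> carrier D"
  then show "x \<otimes>\<^bsub>D\<^esub> a \<in> ord_ge i" "a \<otimes>\<^bsub>D\<^esub> x \<in> ord_ge i"
    using ord_ge_mult[of a i x 0] ord_ge_0 by (auto simp: mult.commute simp del: semigroup_ring_simps(1))
qed

lemma ord_ge_1_iff: "f \<in> ord_ge 1 \<longleftrightarrow> f \<in> carrier D \<and> fps_nth f 0 = 0"
proof -
  have *: "n \<in> mult_M S 1 \<longleftrightarrow> n \<in> S \<and> n \<noteq> 0" for n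
    using one_le_mult_M[of n] mult_M_subset[of 1] mult_M_ge[of n 1] m_pos by auto
  have "f \<in> ord_ge 1 \<longleftrightarrow> (\<forall>n. fps_nth f n \<noteq> 0 \<longrightarrow> n \<in> S \<and> n \<noteq> 0)"
    by (simp only: ord_ge_iff *)
  also have "\<dots> \<longleftrightarrow> (\<forall>n. fps_nth f n \<noteq> 0 \<longrightarrow> n \<in> S) \<and> fps_nth f 0 = 0"
    by metis
  finally show ?thesis by (simp only: semigroup_ring_simps(1))
qed

text \<open>The recursion for the inverse writes an exponent \<open>n > 0\<close> in its support as
  \<open>i + (n - i)\<close>, with \<open>i \<ge> 1\<close> from the support of \<open>f\<close> and
  \<open>n - i\<close> covered by induction.\<close>

lemma D_unit:
  fixes f :: "'k::field fps"
  assumes f: "f \<in> carrier D" and "fps_nth f 0 \<noteq> 0"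
  shows "inverse f \<in> carrier D"
proof -
  have "n \<in> S" if "fps_nth (inverse f) n \<noteq> 0" for n
    using that
  proof (induction n rule: less_induct)
    case (less n)
    show ?case
    proof (cases "n = 0")
      case True
      then show ?thesis using zero_in by simp
    next
      case False
      have "inverse f * f = 1" using assms(2) by (simp add: inverse_mult_eq_1)
      then have "fps_nth (f * inverse f) n = 0" using False by (simp add: mult.commute)
      then have "(\<Sum>i=0..n. fps_nth f i * fps_nth (inverse f) (n - i)) = 0" by (simp only: fps_mult_nth)
      moreover have "(\<Sum>i=0..n. fps_nth f i * fps_nth (inverse f) (n - i)) =
        fps_nth f 0 * fps_nth (inverse f) n + (\<Sum>i=1..n. fps_nth f i * fps_nth (inverse f) (n - i))"
        by (simp add: sum.atLeast_Suc_atMost)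
      ultimately have "(\<Sum>i=1..n. fps_nth f i * fps_nth (inverse f) (n - i)) \<noteq> 0"
        using assms(2) less.prems by (metis add.right_neutral mult_eq_0_iff)
      then obtain i where i: "i \<in> {1..n}" "fps_nth f i * fps_nth (inverse f) (n - i) \<noteq> 0"
        by (elim sum.not_neutral_contains_not_neutral)
      then have "n - i \<in> S" using less.IH[of "n - i"] by auto
      moreover have "i \<in> S" using f i by auto
      ultimately show ?thesis using add_in[of i "n - i"] i(1) by simp
    qed
  qed
  then show ?thesis by simp
qed

text \<open>A series in \<open>D\<close> with nonzero constant coefficient is a unit, so
  \<open>D\<close> is local.\<close>

lemma maximal_ideal_eq:
  assumes "maximalideal N (D :: 'k::field fps ring)"
  shows "N = ord_ge 1"
proof -
  interpret N: maximalideal N "D :: 'k fps ring" by (rule assms)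
  have "f \<in> ord_ge 1" if f: "f \<in> N" for f
  proof -
    have fc: "f \<in> carrier D" using N.Icarr[OF f] .
    have "fps_nth f 0 = 0"
    proof (rule ccontr)
      assume nz: "fps_nth f 0 \<noteq> 0"
      have "inverse f \<otimes>\<^bsub>D\<^esub> f \<in> N" by (rule N.I_l_closed[OF f D_unit[OF fc nz]])
      then have "\<one>\<^bsub>D\<^esub> \<in> N" using nz by (simp add: inverse_mult_eq_1)
      then show False using N.one_imp_carrier N.I_notcarr by simp
    qed
    then show ?thesis using fc ord_ge_1_iff by blast
  qed
  moreover have "ord_ge 1 \<noteq> carrier (D :: 'k fps ring)"
  proof -
    have "(1 :: 'k fps) \<notin> ord_ge 1" "1 \<in> carrier (D :: 'k fps ring)"
      using ord_ge_1_iff[of "1 :: 'k fps"] zero_in by (auto simp: fps_one_nth)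
    then show ?thesis by blast
  qed
  ultimately show ?thesis
    using N.I_maximal[OF ord_ge_ideal[of 1]] ord_ge_carrier[of _ 1] by blast
qed

text \<open>A series of order at least \<open>i + 1\<close> is split according to the residue classes of its exponents modulo \<open>m\<close>,
  since the part in one class is \<open>t\<^sup>g h\<close>, where \<open>g\<close> is the least element of \<open>(i + 1) M\<close> in that class and
  \<open>h\<close> is a series in \<open>t\<^sup>m\<close>.\<close>

lemma ord_ge_Suc_subset:
  "ord_ge (Suc i) \<subseteq> ideal_prod D (ord_ge i) (ord_ge 1 :: 'k::field fps set)"
proof
  fix f :: "'k fps" assume f: "f \<in> ord_ge (Suc i)"
  let ?P = "ideal_prod D (ord_ge i) (ord_ge 1 :: 'k fps set)"
  define part where "part r = Abs_fps (\<lambda>n. if n mod m = r then fps_nth f n else 0)" for r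
  have zero_in_P: "0 \<in> ?P"
    using ideal_prod.prod[of 0 "ord_ge i" 0 "ord_ge 1" D] by (simp add: ord_ge_iff)
  have part_in: "part r \<in> ?P" for r
  proof (cases "part r = 0")
    case True
    then show ?thesis using zero_in_P by simp
  next
    case False
    then obtain n0 where "fps_nth (part r) n0 \<noteq> 0" by (auto simp: fps_eq_iff)
    then have n0: "n0 \<in> mult_M S (Suc i) \<and> n0 mod m = r"
      using f by (auto simp: part_def ord_ge_iff split: if_splits)
    define g where "g = (LEAST n. n \<in> mult_M S (Suc i) \<and> n mod m = r)"
    have g: "g \<in> mult_M S (Suc i)" "g mod m = r"
      using LeastI[of "\<lambda>n. n \<in> mult_M S (Suc i) \<and> n mod m = r", OF n0] by (auto simp: g_def)
    have g_le: "g \<le> n" if "n \<in> mult_M S (Suc i)" "n mod m = r" for n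
      using that unfolding g_def by (intro Least_le) simp
    obtain a y where a: "a \<in> S - {0}" and y: "y \<in> mult_M S i" and g_eq: "g = a + y"
      using g(1) mult_M_Suc by blast
    define h where "h = Abs_fps (\<lambda>n. if m dvd n then fps_nth f (g + n) else 0)"
    have "part r = fps_X ^ g * h"
    proof (rule fps_ext)
      fix n
      show "fps_nth (part r) n = fps_nth (fps_X ^ g * h) n"
      proof (cases "n < g")
        case True
        then have "fps_nth (part r) n = 0"
          using g_le[of n] f by (auto simp: part_def ord_ge_iff)
        then show ?thesis using True by (simp add: fps_X_power_mult_nth)
      next
        case False
        then have "m dvd n - g \<longleftrightarrow> n mod m = r"
          using g(2) mod_eq_dvd_iff_nat[of g n m] by auto
        then show ?thesis using False by (simp add: part_def h_def fps_X_power_mult_nth)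
      qed
    qed
    \<comment> \<open>A nonzero summand \<open>a\<close> split off from \<open>g\<close> gives the
      factor in \<open>ord_ge 1\<close>. The other factor stays in \<open>ord_ge i\<close>, as
      \<open>h\<close> only adds multiples of \<open>m\<close> to \<open>y\<close>.\<close>
    then have part_eq: "part r = (fps_X ^ y * h) \<otimes>\<^bsub>D\<^esub> fps_X ^ a"
      by (simp add: g_eq power_add mult_ac)
    have Xa: "(fps_X :: 'k fps) ^ a \<in> ord_ge 1"
      using a one_le_mult_M[of a] by (simp add: ord_ge_iff fps_X_power_nth)
    have Xh: "fps_X ^ y * h \<in> ord_ge i"
      unfolding ord_ge_iff
    proof (intro allI impI)
      fix n assume "fps_nth (fps_X ^ y * h) n \<noteq> 0"
      then have "y \<le> n" "m dvd n - y" by (auto simp: fps_X_power_mult_nth h_def split: if_splits)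
      then obtain k where "n - y = m * k" unfolding dvd_def by blast
      then have "n = y + k * m" using \<open>y \<le> n\<close> by (simp add: mult.commute)
      then show "n \<in> mult_M S i" using mult_M_add[OF y, of "k * m" 0] add_mult_m_in[OF zero_in, of k] by simp
    qed
    show ?thesis unfolding part_eq by (rule ideal_prod.prod[OF Xh Xa])
  qed
  have sum_in: "(\<Sum>r\<in>A. part r) \<in> ?P" if "finite A" for A
    using that
  proof induction
    case (insert r A)
    then have "part r \<oplus>\<^bsub>D\<^esub> sum part A \<in> ?P" by (intro ideal_prod.sum part_in)
    then show ?case using insert.hyps by simp
  qed (use zero_in_P in simp)
  have "f = (\<Sum>r<m. part r)"
  proof (rule fps_ext)
    fix n
    have "fps_nth (\<Sum>r<m. part r) n = (\<Sum>r<m. if n mod m = r then fps_nth f n else 0)"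
      by (simp only: fps_sum_nth part_def fps_nth_Abs_fps)
    also have "\<dots> = fps_nth f n" using m_pos by (subst sum.delta') simp_all
    finally show "fps_nth f n = fps_nth (\<Sum>r<m. part r) n" by simp
  qed
  then show "f \<in> ?P" using sum_in[of "{..<m}"] by simp
qed

lemma ideal_pow_eq: "ideal_pow D (ord_ge 1 :: 'k::field fps set) i = ord_ge i"
proof (induction i)
  case 0
  then show ?case by (simp add: nat_pow_def ideals_set_def ord_ge_0 del: semigroup_ring_simps(1))
next
  case (Suc i)
  have "ideal_pow D (ord_ge 1 :: 'k fps set) (Suc i) = ideal_prod D (ord_ge i) (ord_ge 1)"
    using Suc by (simp add: nat_pow_def ideals_set_def)
  moreover have "ideal_prod D (ord_ge i) (ord_ge 1 :: 'k fps set) \<subseteq> ord_ge (Suc i)"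
  proof
    fix f :: "'k fps" assume "f \<in> ideal_prod D (ord_ge i) (ord_ge 1)"
    then show "f \<in> ord_ge (Suc i)"
    proof induction
      case (prod a c)
      then show ?case using ord_ge_mult[of a i c 1] by simp
    next
      case (sum a c)
      then show ?case using ord_ge_add by simp
    qed
  qed
  ultimately show ?case using ord_ge_Suc_subset by blast
qed

section \<open>The associated graded ring\<close>

text \<open>The test \<open>n \<in> S\<close> excludes exponents where \<open>sg_ord\<close> is
  unspecified.\<close>

definition homogeneous_part :: "nat \<Rightarrow> 'k::field poly \<Rightarrow> 'k fps" where
  "homogeneous_part i f = Abs_fps (\<lambda>n. if n \<in> S \<and> sg_ord S n = i then coeff f n else 0)"

definition gr_iso :: "'k::field poly \<Rightarrow> nat \<Rightarrow> 'k fps set" where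
  "gr_iso f i = ord_ge (Suc i) +>\<^bsub>D\<^esub> homogeneous_part i f"

abbreviation G :: "(nat \<Rightarrow> 'k::field fps set) ring" where
  "G \<equiv> assoc_graded D (ord_ge 1)"

lemma homogeneous_part_in: "homogeneous_part i f \<in> ord_ge i"
  using mem_mult_M_iff by (auto simp: ord_ge_iff homogeneous_part_def split: if_splits)

lemma coset_eq_iff:
  fixes f g :: "'k::field fps"
  assumes "f \<in> carrier D" "g \<in> carrier D"
  shows "ord_ge i +>\<^bsub>D\<^esub> f = ord_ge i +>\<^bsub>D\<^esub> g \<longleftrightarrow> f - g \<in> ord_ge i"
proof -
  interpret D: cring "D :: 'k fps ring" by (rule D_cring)
  show ?thesis
    using D.quotient_eq_iff_same_a_r_cos[OF ord_ge_ideal assms, of i] D_minus[OF assms] by simp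
qed

lemma G_carrier: "x \<in> carrier (G :: (nat \<Rightarrow> 'k::field fps set) ring) \<longleftrightarrow>
  (\<forall>i. \<exists>a\<in>ord_ge i. x i = ord_ge (Suc i) +>\<^bsub>D\<^esub> a) \<and> finite {i. x i \<noteq> ord_ge (Suc i)}"
  unfolding assoc_graded_def Let_def graded_piece_def ideal_pow_eq by (auto simp: FactRing_def)

lemma G_one: "one (G :: (nat \<Rightarrow> 'k::field fps set) ring) =
    (\<lambda>i. if i = 0 then ord_ge (Suc i) +>\<^bsub>D\<^esub> 1 else ord_ge (Suc i))"
  and G_zero: "zero (G :: (nat \<Rightarrow> 'k::field fps set) ring) = (\<lambda>i. ord_ge (Suc i))"
  and G_add: "add (G :: (nat \<Rightarrow> 'k::field fps set) ring) = (\<lambda>x y i. x i <+>\<^bsub>D\<^esub> y i)"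
  and G_mult: "mult (G :: (nat \<Rightarrow> 'k::field fps set) ring) = (\<lambda>x y d. finsum (D Quot ord_ge (Suc d))
     (\<lambda>i. [mod ord_ge (Suc d):] (x i) \<Otimes>\<^bsub>D\<^esub> (y (d - i))) {..d})"
  unfolding assoc_graded_def Let_def ideal_pow_eq by (auto simp: FactRing_def fun_eq_iff)

text \<open>\<open>rcoset_mult\<close> is a union over all representatives. For
  \<open>a' = u + a\<close> and \<open>c' = v + c\<close> the products differ by
  \<open>a' * v + u * c\<close>, of order at least \<open>i + j + 1\<close>, so all members of the
  union coincide.\<close>

lemma rcoset_mult_ord_ge:
  fixes a c :: "'k::field fps"
  assumes a: "a \<in> ord_ge i" and c: "c \<in> ord_ge j"
  shows "[mod ord_ge (Suc (i + j)):] (ord_ge (Suc i) +>\<^bsub>D\<^esub> a) \<Otimes>\<^bsub>D\<^esub> (ord_ge (Suc j) +>\<^bsub>D\<^esub> c)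
    = ord_ge (Suc (i + j)) +>\<^bsub>D\<^esub> (a * c)"
proof -
  let ?I = "ord_ge (Suc (i + j)) :: 'k fps set"
  have *: "?I +>\<^bsub>D\<^esub> (a' * c') = ?I +>\<^bsub>D\<^esub> (a * c)"
    if ac': "a' \<in> ord_ge (Suc i) +>\<^bsub>D\<^esub> a" "c' \<in> ord_ge (Suc j) +>\<^bsub>D\<^esub> c" for a' c'
  proof -
    obtain u v where u: "u \<in> ord_ge (Suc i)" "a' = u + a" and v: "v \<in> ord_ge (Suc j)" "c' = v + c"
      using ac' by (auto simp: a_r_coset_def')
    have u': "u \<in> ord_ge i" using u(1) ord_ge_antimono[of i "Suc i"] by auto
    have a'i: "a' \<in> ord_ge i" unfolding u(2) by (rule ord_ge_add[OF u' a])
    have "a' * v \<in> ?I" using ord_ge_mult[OF a'i v(1)] by simp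
    moreover have "u * c \<in> ?I" using ord_ge_mult[OF u(1) c] by simp
    ultimately have "a' * v + u * c \<in> ?I" by (rule ord_ge_add)
    moreover have "a' * c' - a * c = a' * v + u * c" by (simp add: u(2) v(2) algebra_simps)
    ultimately have d: "a' * c' - a * c \<in> ?I" by simp
    have ac: "a * c \<in> carrier D" using ord_ge_carrier[OF ord_ge_mult[OF a c]] .
    have "a * c \<in> ord_ge (i + j)" by (rule ord_ge_mult[OF a c])
    moreover have "a' * c' - a * c \<in> ord_ge (i + j)" using d ord_ge_antimono[of "i + j" "Suc (i + j)"] by auto
    ultimately have "(a' * c' - a * c) + a * c \<in> ord_ge (i + j)" using ord_ge_add by blast
    then have "a' * c' \<in> carrier D" using ord_ge_carrier[of "a' * c'" "i + j"] by simp
    then show ?thesis using coset_eq_iff[OF _ ac] d by blast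
  qed
  \<comment> \<open>The union of a constant family collapses only over nonempty index sets.\<close>
  have ne: "a \<in> ord_ge (Suc i) +>\<^bsub>D\<^esub> a" "c \<in> ord_ge (Suc j) +>\<^bsub>D\<^esub> c"
    by (auto simp: a_r_coset_def' ord_ge_iff intro!: bexI[of _ 0])
  have "(\<Union>a'\<in>ord_ge (Suc i) +>\<^bsub>D\<^esub> a. \<Union>c'\<in>ord_ge (Suc j) +>\<^bsub>D\<^esub> c. ?I +>\<^bsub>D\<^esub> (a' \<otimes>\<^bsub>D\<^esub> c')) =
    (\<Union>a'\<in>ord_ge (Suc i) +>\<^bsub>D\<^esub> a. \<Union>c'\<in>ord_ge (Suc j) +>\<^bsub>D\<^esub> c. ?I +>\<^bsub>D\<^esub> (a * c))"
    by (intro SUP_cong refl) (simp only: semigroup_ring_simps(2) *)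
  also have "\<dots> = ?I +>\<^bsub>D\<^esub> (a * c)" using ne by blast
  finally show ?thesis unfolding rcoset_mult_def .
qed

lemma finsum_cosets:
  fixes c :: "nat \<Rightarrow> 'k::field fps"
  assumes c: "\<And>i. i \<in> A \<Longrightarrow> c i \<in> carrier D" and "finite A"
  shows "finsum (D Quot ord_ge j) (\<lambda>i. ord_ge j +>\<^bsub>D\<^esub> c i) A = ord_ge j +>\<^bsub>D\<^esub> (\<Sum>i\<in>A. c i)"
proof -
  interpret D: cring "D :: 'k fps ring" by (rule D_cring)
  interpret h: ring_hom_cring "D :: 'k fps ring" "D Quot ord_ge j" "(+>\<^bsub>D\<^esub>) (ord_ge j)"
    by (rule ideal.rcos_ring_hom_cring[OF ord_ge_ideal D_cring])
  have "finsum D c A = (\<Sum>i\<in>A. c i)"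
    using \<open>finite A\<close> c
  proof (induction A)
    case (insert i A)
    then have "c \<in> A \<rightarrow> carrier D" "c i \<in> carrier D" by blast+
    moreover have "finsum D c A = sum c A" using insert.IH insert.prems by blast
    ultimately show ?case using insert.hyps D.finsum_insert[OF insert.hyps(1,2), of c] by simp
  qed simp
  moreover have "c \<in> A \<rightarrow> carrier D" using c by blast
  ultimately show ?thesis using h.hom_finsum[of c A] by (simp add: comp_def)
qed

text \<open>Degree \<open>d\<close> is compared modulo \<open>ord_ge (Suc d)\<close>, so only
  exponents \<open>n\<close> outside \<open>(d + 1)M\<close> matter. If two orders with sum
  \<open>d\<close> belong to a decomposition of such an \<open>n\<close>, superadditivity forces
  \<open>n\<close> to have order exactly \<open>d\<close>.\<close>

lemma gr_iso_hom:
  fixes f g :: "'k::field poly"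
  assumes f: "f \<in> carrier (gr_ring S)" and g: "g \<in> carrier (gr_ring S)"
  shows "gr_iso (gr_mult S f g) = gr_iso f \<otimes>\<^bsub>G\<^esub> gr_iso g"
proof
  fix d
  let ?c = "\<lambda>i. homogeneous_part i f * homogeneous_part (d - i) g"
  have "rcoset_mult D (ord_ge (Suc d)) (gr_iso f i) (gr_iso g (d - i)) = ord_ge (Suc d) +>\<^bsub>D\<^esub> ?c i"
    if "i \<le> d" for i
    using rcoset_mult_ord_ge[OF homogeneous_part_in[of i f] homogeneous_part_in[of "d - i" g]] that
    by (simp add: gr_iso_def)
  then have terms: "\<And>i. i \<in> {..d} \<Longrightarrow>
    rcoset_mult D (ord_ge (Suc d)) (gr_iso f i) (gr_iso g (d - i)) = ord_ge (Suc d) +>\<^bsub>D\<^esub> ?c i"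
    by simp
  have c_in: "?c i \<in> carrier D" for i
    by (rule ord_ge_carrier[OF ord_ge_mult[OF homogeneous_part_in homogeneous_part_in]])
  interpret D: cring "D :: 'k fps ring" by (rule D_cring)
  interpret Q: cring "(D :: 'k fps ring) Quot ord_ge (Suc d)"
    by (rule ideal.quotient_is_cring[OF ord_ge_ideal D_cring])
  have coset_in: "ord_ge (Suc d) +>\<^bsub>D\<^esub> ?c i \<in> carrier (D Quot ord_ge (Suc d))" for i
    using c_in[of i] by (auto simp: FactRing_def A_RCOSETS_defs a_r_coset_defs)
  have "(gr_iso f \<otimes>\<^bsub>G\<^esub> gr_iso g) d =
     finsum (D Quot ord_ge (Suc d)) (\<lambda>i. ord_ge (Suc d) +>\<^bsub>D\<^esub> ?c i) {..d}"
    unfolding G_mult by (rule Q.finsum_cong') (use terms coset_in in auto)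
  also have "\<dots> = ord_ge (Suc d) +>\<^bsub>D\<^esub> (\<Sum>i\<le>d. ?c i)"
    by (rule finsum_cosets) (use c_in in auto)
  also have "\<dots> = gr_iso (gr_mult S f g) d"
    unfolding gr_iso_def
  proof (subst coset_eq_iff)
    have fin: "(\<Sum>i\<in>A. ?c i) \<in> carrier D" if "finite A" for A
      using that
    proof induction
      case (insert x A)
      then show ?case using D.a_closed[OF c_in, of _ x] by simp
    qed simp
    show "(\<Sum>i\<le>d. ?c i) \<in> carrier D" by (rule fin) simp
    show "homogeneous_part d (gr_mult S f g) \<in> carrier D"
      by (rule ord_ge_carrier[OF homogeneous_part_in])
    show "(\<Sum>i\<le>d. ?c i) - homogeneous_part d (gr_mult S f g) \<in> ord_ge (Suc d)"
      unfolding ord_ge_iff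
    proof (intro allI impI, rule ccontr)
      fix n assume nz: "fps_nth ((\<Sum>i\<le>d. ?c i) - homogeneous_part d (gr_mult S f g)) n \<noteq> 0"
        and n: "n \<notin> mult_M S (Suc d)"
      let ?w = "\<lambda>a. a \<in> S \<and> n - a \<in> S \<and> sg_ord S a + sg_ord S (n - a) = d"
      have "fps_nth (\<Sum>i\<le>d. ?c i) n = (\<Sum>i\<le>d. \<Sum>a=0..n. of_bool (a \<in> S \<and> sg_ord S a = i \<and>
          n - a \<in> S \<and> sg_ord S (n - a) = d - i) * coeff f a * coeff g (n - a))"
        unfolding fps_sum_nth fps_mult_nth by (intro sum.cong) (auto simp: homogeneous_part_def)
      also have "\<dots> = (\<Sum>a=0..n. \<Sum>i\<le>d. of_bool (a \<in> S \<and> sg_ord S a = i \<and>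
          n - a \<in> S \<and> sg_ord S (n - a) = d - i) * coeff f a * coeff g (n - a))"
        by (rule sum.swap)
      also have "\<dots> = (\<Sum>a=0..n. of_bool (?w a) * coeff f a * coeff g (n - a))"
      \<comment> \<open>For fixed \<open>a\<close>, only \<open>i = sg_ord S a\<close> contributes
        to the inner sum.\<close>
      proof (rule sum.cong, rule refl)
        fix a
        have "(\<Sum>i\<le>d. of_bool (a \<in> S \<and> sg_ord S a = i \<and>
          n - a \<in> S \<and> sg_ord S (n - a) = d - i) * coeff f a * coeff g (n - a)) =
          (\<Sum>i\<le>d. if sg_ord S a = i then of_bool (?w a) * coeff f a * coeff g (n - a) else 0)"
          by (rule sum.cong) auto
        also have "\<dots> = of_bool (?w a) * coeff f a * coeff g (n - a)"
          by (auto simp: sum.delta')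
        finally show "(\<Sum>i\<le>d. of_bool (a \<in> S \<and> sg_ord S a = i \<and>
          n - a \<in> S \<and> sg_ord S (n - a) = d - i) * coeff f a * coeff g (n - a)) =
          of_bool (?w a) * coeff f a * coeff g (n - a)" .
      qed
      finally have eq1: "fps_nth (\<Sum>i\<le>d. ?c i) n =
        (\<Sum>a=0..n. of_bool (?w a) * coeff f a * coeff g (n - a))" .
      have eq2: "fps_nth (homogeneous_part d (gr_mult S f g)) n =
        (\<Sum>a=0..n. of_bool (?w a) * coeff f a * coeff g (n - a))"
      proof (cases "n \<in> S \<and> sg_ord S n = d")
        case True
        then show ?thesis
          by (auto simp: homogeneous_part_def coeff_gr_mult ord_additive_def intro!: sum.cong)
      next
        case False
        have "\<not> ?w a" if "a \<le> n" for a
        proof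
          assume w: "?w a"
          then have "n \<in> S" "d \<le> sg_ord S n"
            using add_in[of a "n - a"] sg_ord_add[of a "n - a"] \<open>a \<le> n\<close> by auto
          then show False using False n mem_mult_M_iff[of n "Suc d"] by auto
        qed
        then have "(\<Sum>a=0..n. of_bool (?w a) * coeff f a * coeff g (n - a)) = 0"
          by (intro sum.neutral ballI) auto
        then show ?thesis using False by (simp only: homogeneous_part_def fps_nth_Abs_fps if_False)
      qed
      show False using nz eq1 eq2 by simp
    qed
  qed
  finally show "gr_iso (gr_mult S f g) d = (gr_iso f \<otimes>\<^bsub>G\<^esub> gr_iso g) d" by simp
qed

lemma gr_iso_closed:
  fixes f :: "'k::field poly"
  shows "gr_iso f \<in> carrier G"
  unfolding G_carrier
proof
  show "\<forall>i. \<exists>a\<in>ord_ge i. gr_iso f i = ord_ge (Suc i) +>\<^bsub>D\<^esub> a"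
    using homogeneous_part_in by (auto simp: gr_iso_def)
  interpret D: cring "D :: 'k fps ring" by (rule D_cring)
  have "gr_iso f i = ord_ge (Suc i)" if "i \<notin> sg_ord S ` {..degree f}" for i
  proof -
    have "homogeneous_part i f = 0"
    proof (rule fps_ext)
      fix n
      have "coeff f n = 0" if "sg_ord S n = i"
        using that \<open>i \<notin> sg_ord S ` {..degree f}\<close> by (intro coeff_eq_0) (auto simp: not_le[symmetric])
      then show "fps_nth (homogeneous_part i f) n = fps_nth 0 n" by (simp add: homogeneous_part_def)
    qed
    then show ?thesis unfolding gr_iso_def
      using D.a_rcos_zero[OF ord_ge_ideal, of 0 "Suc i"] by (simp add: ord_ge_iff)
  qed
  then have "{i. gr_iso f i \<noteq> ord_ge (Suc i)} \<subseteq> sg_ord S ` {..degree f}" by blast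
  then show "finite {i. gr_iso f i \<noteq> ord_ge (Suc i)}" using finite_subset by blast
qed

text \<open>The coefficient at \<open>n\<close> is visible in degree \<open>sg_ord S n\<close>,
  because \<open>n\<close> is not in the next step of the filtration.\<close>

lemma gr_iso_inj: "inj_on gr_iso (carrier (gr_ring S :: 'k::field poly ring))"
proof (rule inj_onI)
  fix f g :: "'k poly"
  assume f: "f \<in> carrier (gr_ring S)" and g: "g \<in> carrier (gr_ring S)" and eq: "gr_iso f = gr_iso g"
  show "f = g"
  proof (rule poly_eqI)
    fix n
    show "coeff f n = coeff g n"
    proof (cases "n \<in> S")
      case True
      let ?i = "sg_ord S n"
      have "homogeneous_part ?i f - homogeneous_part ?i g \<in> ord_ge (Suc ?i)"
        using fun_cong[OF eq, of ?i] coset_eq_iff ord_ge_carrier[OF homogeneous_part_in]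
        unfolding gr_iso_def by blast
      moreover have "n \<notin> mult_M S (Suc ?i)" using mem_mult_M_iff[OF True] by simp
      ultimately have "fps_nth (homogeneous_part ?i f - homogeneous_part ?i g) n = 0"
        unfolding ord_ge_iff by blast
      then show ?thesis using True by (simp add: homogeneous_part_def)
    next
      case False
      then show ?thesis using f g unfolding gr_ring_simps by metis
    qed
  qed
qed

text \<open>The coefficient at \<open>n\<close> is read off from a representative in degree
  \<open>sg_ord S n\<close>. Only finitely many degrees are nonzero, and bounded defect leaves
  finitely many exponents in each, so the result is a polynomial.\<close>

lemma gr_iso_surj:
  assumes x: "x \<in> carrier (G :: (nat \<Rightarrow> 'k::field fps set) ring)"
  shows "\<exists>f\<in>carrier (gr_ring S). gr_iso f = x"
proof -
  have "\<forall>i. \<exists>a. a \<in> ord_ge i \<and> x i = ord_ge (Suc i) +>\<^bsub>D\<^esub> a"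
    using x unfolding G_carrier by blast
  then obtain a where a: "\<And>i. a i \<in> ord_ge i" "\<And>i. x i = ord_ge (Suc i) +>\<^bsub>D\<^esub> a i"
    by metis
  have a_in: "a i \<in> ord_ge (Suc i)" if "x i = ord_ge (Suc i)" for i
  proof -
    have "a i \<in> ord_ge (Suc i) +>\<^bsub>D\<^esub> a i"
      by (auto simp: a_r_coset_def' ord_ge_iff intro!: bexI[of _ 0])
    then show ?thesis using that a(2) by simp
  qed
  define c where "c n = (if n \<in> S then fps_nth (a (sg_ord S n)) n else 0)" for n
  have "finite {i. x i \<noteq> ord_ge (Suc i)}" using x unfolding G_carrier by (rule conjunct2)
  then obtain M where "\<forall>i\<in>{i. x i \<noteq> ord_ge (Suc i)}. i \<le> M"
    unfolding finite_nat_set_iff_bounded_le by (rule exE)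
  then have M: "\<And>i. x i \<noteq> ord_ge (Suc i) \<Longrightarrow> i \<le> M" by simp
  obtain B where B: "\<And>s. s \<in> S \<Longrightarrow> defect s \<le> B" using defect_bounded by blast
  define N where "N = Suc (m * M + B)"
  have c0: "n < N" if nz: "c n \<noteq> 0" for n
  proof -
    have n: "n \<in> S" using nz by (auto simp: c_def split: if_splits)
    have "x (sg_ord S n) \<noteq> ord_ge (Suc (sg_ord S n))"
    proof
      assume "x (sg_ord S n) = ord_ge (Suc (sg_ord S n))"
      then have "n \<in> mult_M S (Suc (sg_ord S n))"
        using a_in nz n unfolding ord_ge_iff c_def by auto
      then show False using mem_mult_M_iff[OF n] by simp
    qed
    then have "m * sg_ord S n \<le> m * M" using M by simp
    then show ?thesis using defect_eq[OF n] B[OF n] unfolding N_def by linarith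
  qed
  define f where "f = Poly (map c [0..<N])"
  have cf: "coeff f n = c n" for n
    using c0[of n] unfolding f_def coeff_Poly_upt by auto
  have "f \<in> carrier (gr_ring S)" by (auto simp: cf c_def)
  moreover have "gr_iso f = x"
  proof
    fix i
    have "homogeneous_part i f - a i \<in> ord_ge (Suc i)"
      unfolding ord_ge_iff
    proof (intro allI impI)
      fix n assume nz: "fps_nth (homogeneous_part i f - a i) n \<noteq> 0"
      show "n \<in> mult_M S (Suc i)"
      proof (cases "n \<in> S \<and> sg_ord S n = i")
        case True
        then show ?thesis using nz by (simp add: homogeneous_part_def cf c_def)
      next
        case False
        then have "fps_nth (a i) n \<noteq> 0" using nz by (auto simp: homogeneous_part_def)
        then have n: "n \<in> mult_M S i" using a(1) unfolding ord_ge_iff by blast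
        then have nS: "n \<in> S" using mult_M_subset by blast
        then show ?thesis using False n mem_mult_M_iff[OF nS] by auto
      qed
    qed
    then show "gr_iso f i = x i"
      unfolding a(2) gr_iso_def
      using coset_eq_iff ord_ge_carrier[OF homogeneous_part_in] ord_ge_carrier[OF a(1)] by blast
  qed
  ultimately show ?thesis by blast
qed

lemma gr_iso_zero: "gr_iso (0 :: 'k::field poly) = \<zero>\<^bsub>G\<^esub>"
proof
  fix i
  interpret D: cring "D :: 'k fps ring" by (rule D_cring)
  have "homogeneous_part i (0 :: 'k poly) = 0" by (rule fps_ext) (simp add: homogeneous_part_def)
  then show "gr_iso (0 :: 'k poly) i = zero G i"
    unfolding gr_iso_def G_zero using D.a_rcos_zero[OF ord_ge_ideal, of 0 "Suc i"] by (simp add: ord_ge_iff)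
qed

lemma gr_iso_ring_iso: "gr_iso \<in> ring_iso (gr_ring S) (G :: (nat \<Rightarrow> 'k::field fps set) ring)"
proof (rule ring_iso_memI)
  interpret D: cring "D :: 'k fps ring" by (rule D_cring)
  fix f g :: "'k poly"
  show "gr_iso f \<in> carrier G" by (rule gr_iso_closed)
  show "gr_iso (f \<oplus>\<^bsub>gr_ring S\<^esub> g) = gr_iso f \<oplus>\<^bsub>G\<^esub> gr_iso g"
  proof
    fix i
    have "homogeneous_part i (f + g) = homogeneous_part i f + homogeneous_part i g"
      by (rule fps_ext) (simp add: homogeneous_part_def)
    then show "gr_iso (f \<oplus>\<^bsub>gr_ring S\<^esub> g) i = (gr_iso f \<oplus>\<^bsub>G\<^esub> gr_iso g) i"
      using ideal.a_rcos_sum[OF ord_ge_ideal[of "Suc i"] ord_ge_carrier[OF homogeneous_part_in[of i f]]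
          ord_ge_carrier[OF homogeneous_part_in[of i g]]]
      unfolding gr_iso_def G_add by simp
  qed
next
  fix f g :: "'k poly" assume "f \<in> carrier (gr_ring S)" "g \<in> carrier (gr_ring S)"
  then show "gr_iso (f \<otimes>\<^bsub>gr_ring S\<^esub> g) = gr_iso f \<otimes>\<^bsub>G\<^esub> gr_iso g"
    using gr_iso_hom by (simp only: gr_ring_simps(2))
next
  interpret D: cring "D :: 'k fps ring" by (rule D_cring)
  show "gr_iso \<one>\<^bsub>gr_ring S\<^esub> = \<one>\<^bsub>G :: (nat \<Rightarrow> 'k fps set) ring\<^esub>"
  proof
    fix i
    have hom: "homogeneous_part i (1 :: 'k poly) = (if i = 0 then 1 else 0)"
      by (rule fps_ext) (use zero_in in \<open>auto simp: homogeneous_part_def coeff_1\<close>)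
    have "(0 :: 'k fps) \<in> ord_ge (Suc i)" by (simp add: ord_ge_iff)
    then have "ord_ge (Suc i) +>\<^bsub>D\<^esub> (0 :: 'k fps) = ord_ge (Suc i)"
      by (rule D.a_rcos_zero[OF ord_ge_ideal])
    then show "gr_iso \<one>\<^bsub>gr_ring S\<^esub> i = one (G :: (nat \<Rightarrow> 'k fps set) ring) i"
      unfolding gr_iso_def G_one gr_ring_simps(3) hom by (cases "i = 0") simp_all
  qed
next
  show "bij_betw gr_iso (carrier (gr_ring S)) (carrier (G :: (nat \<Rightarrow> 'k fps set) ring))"
    unfolding bij_betw_def
  proof
    show "gr_iso ` carrier (gr_ring S) = carrier (G :: (nat \<Rightarrow> 'k fps set) ring)"
    proof
      show "gr_iso ` carrier (gr_ring S) \<subseteq> carrier (G :: (nat \<Rightarrow> 'k fps set) ring)"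
        by (rule image_subsetI) (rule gr_iso_closed)
      show "carrier (G :: (nat \<Rightarrow> 'k fps set) ring) \<subseteq> gr_iso ` carrier (gr_ring S)"
        by (rule subsetI, drule gr_iso_surj, erule bexE) (erule image_eqI[OF sym])
    qed
  qed (rule gr_iso_inj)
qed

text \<open>The retraction is carried over to \<open>G\<close>. Regularity of \<open>t^m\<close>
  makes every nonzero polynomial in it a nonzerodivisor; where regularity fails at \<open>s\<close>,
  the class of \<open>t^s\<close> is killed by that of \<open>t^m\<close>.\<close>

theorem cohen_macaulay_assoc_graded_iff:
  "cohen_macaulay (G :: (nat \<Rightarrow> 'k::field fps set) ring) \<longleftrightarrow>
    (\<forall>s\<in>S. sg_ord S (s + m) = sg_ord S s + 1)"
proof -
  let ?R = "gr_ring S :: 'k poly ring" and ?G = "G :: (nat \<Rightarrow> 'k fps set) ring"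
  interpret R: cring ?R by (rule gr_ring_cring)
  have "cring (?G\<lparr>zero := gr_iso \<zero>\<^bsub>?R\<^esub>\<rparr>)" by (rule R.ring_iso_imp_img_cring[OF gr_iso_ring_iso])
  \<comment> \<open>The transported ring carries the image of zero as its zero, which has to be
    identified with that of \<open>G\<close>.\<close>
  moreover have "gr_iso \<zero>\<^bsub>?R\<^esub> = \<zero>\<^bsub>?G\<^esub>" using gr_iso_zero by simp
  ultimately have G: "cring ?G" by simp
  interpret G: poly_retract ?G "\<lambda>p. gr_iso (stretch m p)"
      "\<lambda>g. unstretch m (inv_into (carrier ?R) gr_iso g)"
    by (rule poly_retract_iso[OF gr_ring_poly_retract G gr_iso_ring_iso])
  interpret h: ring_hom_ring ?R ?G gr_iso
    using ring_hom_ringI2[OF R.ring_axioms G.ring_axioms] gr_iso_ring_iso unfolding ring_iso_def by blast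
  have stretch_in: "stretch m p \<in> carrier ?R" for p
    by (rule poly_retract.\<phi>_closed[OF gr_ring_poly_retract])
  have zero_iff: "gr_iso f = \<zero>\<^bsub>?G\<^esub> \<longleftrightarrow> f = 0" if "f \<in> carrier ?R" for f
    using inj_onD[OF gr_iso_inj _ that, of 0] gr_iso_zero by force
  show ?thesis
  proof
    assume reg: "\<forall>s\<in>S. sg_ord S (s + m) = sg_ord S s + 1"
    show "cohen_macaulay ?G"
    proof (rule G.cohen_macaulayI)
      show "noetherian_ring ?G"
        by (rule noetherian_ring_iso[OF gr_ring_noetherian[OF reg] G.ring_axioms gr_iso_ring_iso])
      fix p :: "'k poly" and g
      assume p: "p \<noteq> 0" and g: "g \<in> carrier ?G" and gp: "g \<otimes>\<^bsub>?G\<^esub> gr_iso (stretch m p) = \<zero>\<^bsub>?G\<^esub>"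
      obtain f where f: "f \<in> carrier ?R" "gr_iso f = g" using gr_iso_surj[OF g] by blast
      have "gr_iso (f \<otimes>\<^bsub>?R\<^esub> stretch m p) = \<zero>\<^bsub>?G\<^esub>"
        using gp f(2) h.hom_mult[OF f(1) stretch_in] by simp
      then have "f \<otimes>\<^bsub>?R\<^esub> stretch m p = \<zero>\<^bsub>?R\<^esub>"
        using zero_iff[OF R.m_closed[OF f(1) stretch_in]] by simp
      then have "f = \<zero>\<^bsub>?R\<^esub>" by (rule gr_ring_stretch_regular[OF reg f(1) p])
      then have f0: "f = 0" by simp
      show "g = \<zero>\<^bsub>?G\<^esub>" unfolding f(2)[symmetric] f0 by (rule gr_iso_zero)
    qed
  next
    assume cm: "cohen_macaulay ?G"
    show "\<forall>s\<in>S. sg_ord S (s + m) = sg_ord S s + 1"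
    proof (rule ballI, rule ccontr)
      fix s assume s: "s \<in> S" "sg_ord S (s + m) \<noteq> sg_ord S s + 1"
      have mon: "monom 1 s \<in> carrier ?R" using s(1) by simp
      have "gr_iso (monom 1 s) \<otimes>\<^bsub>?G\<^esub> gr_iso (stretch m [:0, 1:]) = \<zero>\<^bsub>?G\<^esub>"
        unfolding h.hom_mult[OF mon stretch_in, symmetric] gr_ring_not_regular[OF s] gr_ring_simps(4)
        by (rule gr_iso_zero)
      moreover have "gr_iso (monom 1 s) \<noteq> \<zero>\<^bsub>?G\<^esub>" using zero_iff[OF mon] by simp
      ultimately show False using G.not_cohen_macaulay[OF h.hom_closed[OF mon]] cm by blast
    qed
  qed
qed

end

theorem theorem2p8:
  fixes S E :: "nat set" and b m :: nat
    and D :: "'k::field fps ring" and \<nn> :: "'k fps set"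
  assumes "numerical_semigroup S"
    and "m = sg_multiplicity S"
    and "semigroup_ideal S E"
    and "0 \<notin> E"
    and "b \<in> S"
    and "odd b"
    and "D = semigroup_ring (duplication S b E)"
    and "maximalideal \<nn> D"
  shows "cohen_macaulay (assoc_graded D \<nn>) \<longleftrightarrow>
    (\<forall>i<m. a_sg S i = int (b_sg S i) \<and> a_ideal S E i = int (b_ideal S E i))"
proof -
  interpret sg_duplication S E b
    using assms by unfold_locales
  \<comment> \<open>\<open>D\<close> is local, so \<open>\<nn>\<close> is the ideal whose graded
    ring was computed.\<close>
  have "\<nn> = T.ord_ge 1" using T.maximal_ideal_eq assms(7,8) by blast
  then show ?thesis
    using T.cohen_macaulay_assoc_graded_iff duplication_regular_iff assms(2,7) by simp
qed

end
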